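(* Let $\tau:\mathcal D\to\mathcal D$ be a rearrangement and $T$ the induced operator $Th_I=h_{\tau(I)}$. The following are equivalent: (i) $T:\mathrm{BMO}\to\mathrm{BMO}$ is bounded; (ii) there exists $M\ge1$ such that $[\![\tau(\mathcal L)]\!]\le M[\![\mathcal L]\!]$ for every $\mathcal L\subset\mathcal D$; (iii) $\tau$ satisfies the weak-Property $\mathcal P$.
   Context: $\mathcal D$ is the collection of dyadic subintervals of $[0,1]$. A rearrangement is an injective map $\tau:\mathcal D\to\mathcal D$; $\tau^{-1}$ is its inverse on $\tau(\mathcal D)$. $h_I$ is the $L^\infty$-normalized Haar function ($1$ on the left half of $I$, $-1$ on the right half, $0$ outside). For $x=\sum x_Ih_I$, $\|x\|=\sup_{J\in\mathcal D}\big(\frac1{|J|}\sum_{I\subseteq J}x_I^2|I|\big)^{1/2}$ and $\mathrm{BMO}=\{x:\|x\|<\infty\}$ (dyadic BMO). For $\mathcal L\subset\mathcal D$: $[\![\mathcal L]\!]=\sup_{J\in\mathcal D}\frac1{|J|}\sum_{I\in\mathcal L,I\subseteq J}|I|$; $\mathcal L$ satisfies the $M$ Carleson condition if $[\![\mathcal L]\!]\le M$; $\mathcal L^*=\bigcup_{I\in\mathcal L}I$; $\mathcal L\cap J=\{I\in\mathcal L:I\subseteq J\}$; $\max\mathcal L$ is the set of elements of $\mathcal L$ maximal with respect to inclusion. Weak-Property $\mathcal P$: $\tau$ satisfies the weak-Property $\mathcal P$ if there is $M>0$ such that for every $\mathcal B\subset\mathcal D$ and every $J\in\mathcal D$ the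 collection $\tau(\mathcal B)\cap J$ can be written as a disjoint union $\bigcup_i\tau(\mathcal L_i)\cup\bigcup_i\mathcal E_i$ ($i\in\mathbb N$) such that (a) $\bigcup_i\mathcal E_i$ satisfies the $M$ Carleson condition; (b) $\frac{|\tau(I)|}{|I|}\le M\frac{|\tau(\mathcal L_i)^*|+|\mathcal E_i^*|}{|\mathcal L_i^*|}$ whenever $I\in\mathcal L_i$; (c) $\sum_i|\tau(\mathcal L_i)^*|\le M|J|\sup_i[\![\tau^{-1}(\max\tau(\mathcal L_i))]\!]$. *)

theory Defs
  imports "HOL-Analysis.Analysis"
begin

definition dyadic :: "(nat \<times> nat) set" where
  "dyadic = {(n, k). k < 2 ^ n}"

definition dint :: "nat \<times> nat \<Rightarrow> real set" where
  "dint = (\<lambda>(n, k). {real k / 2 ^ n ..< (real k + 1) / 2 ^ n})"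

definition dlen :: "nat \<times> nat \<Rightarrow> real" where
  "dlen = (\<lambda>(n, k). 1 / 2 ^ n)"

definition dsub :: "(nat \<times> nat) set \<Rightarrow> nat \<times> nat \<Rightarrow> (nat \<times> nat) set" where
  "dsub L J = {I \<in> L \<inter> dyadic. dint I \<subseteq> dint J}"

definition carleson :: "(nat \<times> nat) set \<Rightarrow> ennreal" where
  "carleson L = (SUP J\<in>dyadic. ennreal (1 / dlen J) * (\<Sum>\<^sub>\<infinity> I\<in>dsub L J. ennreal (dlen I)))"

definition dstar :: "(nat \<times> nat) set \<Rightarrow> real set" where
  "dstar L = (\<Union>I\<in>L. dint I)"

definition dmax :: "(nat \<times> nat) set \<Rightarrow> (nat \<times> nat) set" where
  "dmax L = {I \<in> L. \<not> (\<exists>K\<in>L. dint I \<subset> dint K)}"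

text \<open>Square of the dyadic BMO norm of x = \<Sum> x_I h_I (coefficient sequence x).\<close>
definition bmo_sq :: "(nat \<times> nat \<Rightarrow> real) \<Rightarrow> ennreal" where
  "bmo_sq x = (SUP J\<in>dyadic. ennreal (1 / dlen J) *
                 (\<Sum>\<^sub>\<infinity> I\<in>dsub dyadic J. ennreal ((x I)\<^sup>2 * dlen I)))"

definition in_BMO :: "(nat \<times> nat \<Rightarrow> real) \<Rightarrow> bool" where
  "in_BMO x \<longleftrightarrow> bmo_sq x < \<infinity>"

definition bmo_norm :: "(nat \<times> nat \<Rightarrow> real) \<Rightarrow> real" where
  "bmo_norm x = sqrt (enn2real (bmo_sq x))"

definition rearrangement :: "(nat \<times> nat \<Rightarrow> nat \<times> nat) \<Rightarrow> bool" where
  "rearrangement \<tau> \<longleftrightarrow> inj_on \<tau> dyadic \<and> \<tau> ` dyadic \<subseteq> dyadic"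

definition rinv :: "(nat \<times> nat \<Rightarrow> nat \<times> nat) \<Rightarrow> nat \<times> nat \<Rightarrow> nat \<times> nat" where
  "rinv \<tau> = the_inv_into dyadic \<tau>"

text \<open>Induced operator T h_I = h_{tau(I)}, acting on coefficient sequences.\<close>
definition Top :: "(nat \<times> nat \<Rightarrow> nat \<times> nat) \<Rightarrow> (nat \<times> nat \<Rightarrow> real) \<Rightarrow> (nat \<times> nat \<Rightarrow> real)" where
  "Top \<tau> x = (\<lambda>K. if K \<in> \<tau> ` dyadic then x (rinv \<tau> K) else 0)"

definition BMO_bounded :: "(nat \<times> nat \<Rightarrow> nat \<times> nat) \<Rightarrow> bool" where
  "BMO_bounded \<tau> \<longleftrightarrow> (\<exists>C. \<forall>x. in_BMO x \<longrightarrow>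
       in_BMO (Top \<tau> x) \<and> bmo_norm (Top \<tau> x) \<le> C * bmo_norm x)"

definition weak_property_P :: "(nat \<times> nat \<Rightarrow> nat \<times> nat) \<Rightarrow> bool" where
  "weak_property_P \<tau> \<longleftrightarrow> (\<exists>M::real>0. \<forall>B\<subseteq>dyadic. \<forall>J\<in>dyadic.
     \<exists>L E :: nat \<Rightarrow> (nat \<times> nat) set.
       (\<forall>i. L i \<subseteq> dyadic \<and> E i \<subseteq> dyadic) \<and>
       dsub (\<tau> ` B) J = (\<Union>i. \<tau> ` L i) \<union> (\<Union>i. E i) \<and>
       (\<forall>i j. i \<noteq> j \<longrightarrow> \<tau> ` L i \<inter> \<tau> ` L j = {} \<and> E i \<inter> E j = {}) \<and>
       (\<forall>i j. \<tau> ` L i \<inter> E j = {}) \<and>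
       carleson (\<Union>i. E i) \<le> ennreal M \<and>
       (\<forall>i. \<forall>I\<in>L i. dlen (\<tau> I) / dlen I \<le>
           M * (measure lborel (dstar (\<tau> ` L i)) + measure lborel (dstar (E i)))
             / measure lborel (dstar (L i))) \<and>
       (\<Sum>i. ennreal (measure lborel (dstar (\<tau> ` L i))))
          \<le> ennreal (M * dlen J) * (SUP i. carleson (rinv \<tau> ` dmax (\<tau> ` L i))))"

end

theory Submission
  imports Defs
begin

text \<open>
  (i) to (ii): apply the operator to indicator sequences.

  (iii) to (i): summing (b) over the intervals of the collections and inserting (a) and (c) bounds
  the Carleson constant of the image of a collection by a quadratic polynomial in the Carleson constant
  of the collection; in particular \<open>\<tau>\<close> maps collections with Carleson constant at most 2 to
  uniformly Carleson collections. A coefficient sequence of norm 1 gives a weight \<open>w = x\<^sup>2\<close> of Carleson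
  norm 1, and every such weight is an average of indicators of collections with Carleson constant at
  most 2, so the bound passes to all of BMO.

  (ii) to (iii): let \<open>L\<close> consist of the \<open>I\<close> in \<open>B\<close> with \<open>\<tau> I\<close> inside \<open>J\<close>, and let the tops be the
  intervals of \<open>L\<close> at which \<open>|\<tau> I| / |I|\<close> exceeds its value at all larger intervals of \<open>L\<close>. Group
  every \<open>I\<close> with a top \<open>T\<close> above it that has at least the same ratio, and take all \<open>E\<close> empty. Ratios
  are powers of two, so they double along chains of tops, and (ii) for collections with Carleson
  constant 4 gives \<open>\<Sum> |\<tau> T| \<le> 12 M |J|\<close>. Comparing lengths within the group \<open>L\<^sub>T\<close> of \<open>T\<close> gives that
  \<open>\<tau>(L\<^sub>T)\<^sup>*\<close> has measure at most \<open>|\<tau> T|\<close> times the Carleson constant of the \<open>\<tau>\<close>-preimage of the maximal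
  elements of \<open>\<tau>(L\<^sub>T)\<close>.
\<close>

subsection \<open>Dyadic intervals and packing\<close>

text \<open>Finite-sum form of the Carleson condition, for a weight \<open>w\<close> carried by the collection \<open>L\<close>: the case
  \<open>w = 1\<close> is \<open>carleson L \<le> C\<close>, the case \<open>w = x\<^sup>2\<close> is \<open>bmo_sq x \<le> C\<close>.\<close>

definition packing :: "(nat \<times> nat) set \<Rightarrow> (nat \<times> nat \<Rightarrow> real) \<Rightarrow> real \<Rightarrow> bool" where
  "packing L w C \<longleftrightarrow> (\<forall>J\<in>dyadic. \<forall>F. finite F \<longrightarrow> F \<subseteq> dsub L J \<longrightarrow>
     (\<Sum>I\<in>F. w I * dlen I) \<le> C * dlen J)"

lemma packingD:
  assumes "packing L w C" "J \<in> dyadic" "finite F" "F \<subseteq> dsub L J"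
  shows "(\<Sum>I\<in>F. w I * dlen I) \<le> C * dlen J"
  using assms unfolding packing_def by blast

lemma dsub_mono: "K \<subseteq> L \<Longrightarrow> dsub K J \<subseteq> dsub L J"
  by (auto simp: dsub_def)

lemma packing_subset: "packing L w C \<Longrightarrow> K \<subseteq> L \<Longrightarrow> packing K w C"
  unfolding packing_def by (meson dsub_mono order_trans)

section \<open>Elementary geometry of dyadic intervals\<close>

lemma dlen_pos [simp]: "0 < dlen I"
  by (simp add: dlen_def split: prod.split)

lemma dlen_nonneg [simp]: "0 \<le> dlen I"
  using dlen_pos less_le by blast

lemma dlen_not_le_0 [simp]: "\<not> dlen I \<le> 0" "dlen I \<noteq> 0"
  using dlen_pos[of I] by linarith+

lemma dlen_eq: "dlen I = 1 / 2 ^ fst I"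
  by (simp add: dlen_def split: prod.split)

lemma dint_nonempty: "dint I \<noteq> {}"
  by (auto simp: dint_def divide_strict_right_mono split: prod.split)

lemma dint_measurable [measurable, simp]: "dint I \<in> sets borel" "dint I \<in> sets lborel"
  by (auto simp: dint_def split: prod.split)

lemma emeasure_dint: "emeasure lborel (dint I) = ennreal (dlen I)"
  by (auto simp: dint_def dlen_def divide_right_mono diff_divide_distrib[symmetric] split: prod.split)

lemma measure_dint [simp]: "measure lborel (dint I) = dlen I"
  by (simp add: measure_def emeasure_dint)

lemma dint_fmeasurable [simp]: "dint I \<in> fmeasurable lborel"
  by (simp add: fmeasurable_def emeasure_dint)

lemma dint_subset_len:
  assumes "dint I \<subseteq> dint J" shows "dlen I \<le> dlen J"
  using measure_mono_fmeasurable[OF assms, of lborel] by simp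

lemma dint_subset_level:
  assumes "dint I \<subseteq> dint J" shows "fst J \<le> fst I"
  using dint_subset_len[OF assms] by (simp add: dlen_eq divide_simps)

text \<open>The floor form turns nestedness into integer division.\<close>

lemma dint_mem_iff: "x \<in> dint (n, k) \<longleftrightarrow> \<lfloor>x * 2 ^ n\<rfloor> = int k"
  by (auto simp: dint_def floor_eq_iff field_simps)

lemma dint_eq_level:
  assumes "x \<in> dint I" "x \<in> dint J" "fst I = fst J" shows "I = J"
  using assms by (cases I; cases J) (auto simp: dint_mem_iff)

lemma dint_inj: "dint I = dint J \<longleftrightarrow> I = J"
proof
  assume eq: "dint I = dint J"
  then have "fst I = fst J" using dint_subset_level[of I J] dint_subset_level[of J I] by simp
  then show "I = J" using dint_nonempty[of I] dint_eq_level[of _ I J] eq by auto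
qed simp

lemma dint_nested:
  assumes "x \<in> dint I" "x \<in> dint J" "fst J \<le> fst I" shows "dint I \<subseteq> dint J"
proof
  fix y assume y: "y \<in> dint I"
  obtain n k where I: "I = (n, k)" by (cases I)
  obtain m l where J: "J = (m, l)" by (cases J)
  from assms(3) I J obtain d where n: "n = m + d" by (auto simp: le_iff_add)
  \<comment> \<open>The level-\<open>m\<close> index of a point is its level-\<open>n\<close> index
    with the last \<open>d\<close> binary digits dropped.\<close>
  have fl: "\<lfloor>z * 2 ^ m\<rfloor> = \<lfloor>z * 2 ^ n\<rfloor> div 2 ^ d" for z :: real
  proof -
    have "\<lfloor>z * 2 ^ m\<rfloor> = \<lfloor>(z * 2 ^ n) / of_int (2 ^ d)\<rfloor>"
      by (simp add: n power_add)
    also have "\<dots> = \<lfloor>z * 2 ^ n\<rfloor> div 2 ^ d"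
      by (subst floor_divide_real_eq_div) simp_all
    finally show ?thesis .
  qed
  show "y \<in> dint J"
    using assms(1,2) y unfolding I J dint_mem_iff fl by simp
qed

lemma dint_cases:
  obtains "dint I \<subseteq> dint J" | "dint J \<subset> dint I" | "dint I \<inter> dint J = {}"
proof (cases "dint I \<inter> dint J = {}")
  case False
  then obtain x where x: "x \<in> dint I" "x \<in> dint J" by auto
  show ?thesis
  proof (cases "fst J \<le> fst I")
    case True then show ?thesis using dint_nested x that by blast
  next
    case False
    then have "dint J \<subseteq> dint I" using dint_nested x by simp
    moreover have "dint J \<noteq> dint I" using False dint_inj by auto
    ultimately show ?thesis using that by blast
  qed
qed

lemma dint_strict_level:
  assumes "dint I \<subset> dint J" shows "fst J < fst I"
proof -
  have "fst J \<le> fst I" using assms dint_subset_level by blast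
  moreover have "fst J \<noteq> fst I"
    using assms dint_nonempty[of I] dint_eq_level[of _ I J] by fastforce
  ultimately show ?thesis by simp
qed

lemma finite_dyadic_level: "finite {I \<in> dyadic. fst I \<le> n}"
proof -
  have "{I \<in> dyadic. fst I \<le> n} \<subseteq> (SIGMA m:{..n}. {..<2 ^ m})"
    by (auto simp: dyadic_def)
  then show ?thesis by (rule finite_subset) auto
qed

lemma finite_dyadic_super: "finite {Q \<in> dyadic. dint I \<subseteq> dint Q}"
  by (rule finite_subset[OF _ finite_dyadic_level[of "fst I"]]) (auto dest: dint_subset_level)

text \<open>A sum of nonnegative terms is the supremum of its finite partial sums, so Carleson and
  BMO bounds can be tested on finite subcollections with real arithmetic.\<close>

lemma SUP_weight_le_iff:
  assumes w: "\<And>I. 0 \<le> w I" and C: "0 \<le> C"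
  shows "(SUP J\<in>dyadic. ennreal (1 / dlen J) * (\<Sum>\<^sub>\<infinity> I\<in>dsub L J. ennreal (w I * dlen I))) \<le> ennreal C
    \<longleftrightarrow> packing L w C"
proof -
  have eq: "ennreal (1 / dlen J) * (\<Sum>\<^sub>\<infinity> I\<in>dsub L J. ennreal (w I * dlen I)) \<le> ennreal C \<longleftrightarrow>
     (\<forall>F. finite F \<longrightarrow> F \<subseteq> dsub L J \<longrightarrow> (\<Sum>I\<in>F. w I * dlen I) \<le> C * dlen J)" for J
  proof -
    have "(\<Sum>\<^sub>\<infinity> I\<in>dsub L J. ennreal (w I * dlen I)) =
      (SUP F\<in>{F. finite F \<and> F \<subseteq> dsub L J}. \<Sum>I\<in>F. ennreal (w I * dlen I))"
      by (rule nonneg_infsum_complete) simp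
    moreover have "ennreal (1 / dlen J) * X \<le> ennreal C \<longleftrightarrow> X \<le> ennreal (C * dlen J)" for X
    proof -
      have 1: "ennreal (dlen J) * ennreal (1 / dlen J) = 1"
        using dlen_pos[of J] by (simp add: less_le flip: ennreal_mult')
      have 2: "ennreal (C * dlen J) = ennreal (dlen J) * ennreal C"
        using C by (simp add: ennreal_mult' mult.commute)
      show ?thesis
      proof
        assume "ennreal (1 / dlen J) * X \<le> ennreal C"
        then have "ennreal (dlen J) * (ennreal (1 / dlen J) * X) \<le> ennreal (dlen J) * ennreal C"
          by (rule mult_left_mono) simp
        then show "X \<le> ennreal (C * dlen J)"
          unfolding 2 mult.assoc[symmetric] 1 by simp
      next
        assume "X \<le> ennreal (C * dlen J)"
        then have "ennreal (1 / dlen J) * X \<le> ennreal (1 / dlen J) * (ennreal (dlen J) * ennreal C)"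
          unfolding 2 by (rule mult_left_mono) simp
        then show "ennreal (1 / dlen J) * X \<le> ennreal C"
          unfolding mult.assoc[symmetric] mult.commute[of "ennreal (1 / dlen J)" "ennreal (dlen J)"] 1 by simp
      qed
    qed
    ultimately show ?thesis
      using w C by (simp add: SUP_le_iff sum_nonneg sum_ennreal imp_conjL)
  qed
  show ?thesis unfolding packing_def SUP_le_iff using eq by blast
qed

lemma carleson_le_iff: "0 \<le> C \<Longrightarrow> carleson L \<le> ennreal C \<longleftrightarrow> packing L (\<lambda>_. 1) C"
  using SUP_weight_le_iff[of "\<lambda>_. 1" C L] by (simp add: carleson_def)

lemma bmo_sq_le_iff: "0 \<le> C \<Longrightarrow> bmo_sq x \<le> ennreal C \<longleftrightarrow> packing dyadic (\<lambda>I. (x I)\<^sup>2) C"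
  using SUP_weight_le_iff[of "\<lambda>I. (x I)\<^sup>2" C dyadic] by (simp add: bmo_sq_def)

lemma sum_UN_le:
  fixes f :: "'a \<Rightarrow> real"
  assumes "finite A" "\<And>i. i \<in> A \<Longrightarrow> finite (B i)" "\<And>x. 0 \<le> f x"
  shows "sum f (\<Union>i\<in>A. B i) \<le> (\<Sum>i\<in>A. sum f (B i))"
  using assms(1,2)
proof (induction rule: finite_induct)
  case (insert i A)
  have "sum f (\<Union>j\<in>insert i A. B j) \<le> sum f (B i) + sum f (\<Union>j\<in>A. B j)"
    using insert.prems insert.hyps assms(3)
    by (simp add: sum_Un sum_nonneg)
  then show ?case using insert by simp
qed simp

text \<open>Sparse collections are Carleson: lengths below \<open>J\<close> add up to at most
  \<open>c\<close> times the total measure of disjoint sets that all lie in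
  \<open>dint J\<close>.\<close>

lemma packing_if_disjoint_parts:
  assumes c: "0 < c" and sub: "\<And>I. I \<in> F \<Longrightarrow> A I \<subseteq> dint I"
    and meas: "\<And>I. I \<in> F \<Longrightarrow> A I \<in> sets lborel"
    and large: "\<And>I. I \<in> F \<Longrightarrow> dlen I \<le> c * measure lborel (A I)"
    and disj: "disjoint_family_on A F"
  shows "packing F (\<lambda>_. 1) c"
  unfolding packing_def
proof (intro ballI allI impI)
  fix J G assume J: "J \<in> dyadic" and G: "finite G" "G \<subseteq> dsub F J"
  have GF: "G \<subseteq> F" using G(2) by (auto simp: dsub_def)
  have fm: "A I \<in> fmeasurable lborel" if "I \<in> G" for I
    using that GF sub[of I] meas[of I] by (intro fmeasurableI2[OF dint_fmeasurable[of I]]) auto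
  have "(\<Sum>I\<in>G. 1 * dlen I) \<le> (\<Sum>I\<in>G. c * measure lborel (A I))"
    using GF large by (intro sum_mono) auto
  also have "\<dots> = c * measure lborel (\<Union>I\<in>G. A I)"
  proof -
    have "measure lborel (\<Union>I\<in>G. A I) = (\<Sum>I\<in>G. measure lborel (A I))"
    proof (rule measure_finite_Union[OF G(1)])
      show "A ` G \<subseteq> sets lborel" using fm by (blast dest: fmeasurableD)
      show "disjoint_family_on A G" using disj GF by (rule disjoint_family_on_mono[rotated])
      show "emeasure lborel (A I) \<noteq> \<infinity>" if "I \<in> G" for I
        using fmeasurableD2[OF fm[OF that]] by simp
    qed
    then show ?thesis by (simp add: sum_distrib_left)
  qed
  also have "\<dots> \<le> c * measure lborel (dint J)"
  proof (intro mult_left_mono measure_mono_fmeasurable sets.finite_UN)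
    show "(\<Union>I\<in>G. A I) \<subseteq> dint J" using G(2) GF sub unfolding dsub_def by blast
  qed (use c fm G(1) in \<open>blast dest: fmeasurableD | simp\<close>)+
  finally show "(\<Sum>I\<in>G. 1 * dlen I) \<le> c * dlen J" by simp
qed

section \<open>Covered sets and maximal intervals\<close>

lemma dstar_measurable [simp]: "dstar L \<in> sets borel" "dstar L \<in> sets lborel"
proof -
  have "countable L" by (rule countableI_type)
  then show "dstar L \<in> sets borel" unfolding dstar_def by (intro sets.countable_UN') auto
  then show "dstar L \<in> sets lborel" by simp
qed

lemma dstar_mono: "K \<subseteq> L \<Longrightarrow> dstar K \<subseteq> dstar L"
  by (auto simp: dstar_def)

text \<open>Each strictly larger interval has a lower level, so the ascent ends even when
  \<open>L\<close> is infinite.\<close>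

lemma ex_dmax_above:
  assumes "I \<in> L" shows "\<exists>K\<in>dmax L. dint I \<subseteq> dint K"
  using assms
proof (induction "fst I" arbitrary: I rule: less_induct)
  case less
  show ?case
  proof (cases "I \<in> dmax L")
    case False
    then obtain K where K: "K \<in> L" "dint I \<subset> dint K" using less by (auto simp: dmax_def)
    from less.hyps[OF dint_strict_level[OF K(2)] K(1)] K show ?thesis by blast
  qed auto
qed

lemma dstar_dmax: "dstar (dmax L) = dstar L"
proof
  show "dstar (dmax L) \<subseteq> dstar L" by (rule dstar_mono) (auto simp: dmax_def)
  show "dstar L \<subseteq> dstar (dmax L)" using ex_dmax_above unfolding dstar_def by blast
qed

lemma dmax_disjoint: "disjoint_family_on dint (dmax L)"
  unfolding disjoint_family_on_def
proof (intro ballI impI)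
  fix I J assume "I \<in> dmax L" "J \<in> dmax L" "I \<noteq> J"
  then show "dint I \<inter> dint J = {}"
    using dint_inj[of I J] by (cases I J rule: dint_cases) (auto simp: dmax_def)
qed

lemma dmax_subset: "dmax L \<subseteq> L"
  by (auto simp: dmax_def)

lemma finite_dmax: "finite L \<Longrightarrow> finite (dmax L)"
  by (rule finite_subset[OF dmax_subset])

lemma measure_dstar_finite:
  assumes "finite F" shows "measure lborel (dstar F) = (\<Sum>I\<in>dmax F. dlen I)"
proof -
  have f: "finite (dmax F)" using assms by (rule finite_dmax)
  have "measure lborel (dstar (dmax F)) = (\<Sum>I\<in>dmax F. measure lborel (dint I))"
    unfolding dstar_def using f dmax_disjoint
    by (intro measure_finite_Union) (auto simp: emeasure_dint)
  then show ?thesis by (simp add: dstar_dmax)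
qed

lemma dstar_fmeasurable:
  assumes "L \<subseteq> dsub dyadic J" shows "dstar L \<in> fmeasurable lborel"
  by (rule fmeasurableI2[OF dint_fmeasurable[of J]]) (use assms in \<open>auto simp: dstar_def dsub_def\<close>)

lemma dyadic_unit: "I \<in> dyadic \<Longrightarrow> dint I \<subseteq> dint (0, 0)"
proof 
  fix x assume I: "I \<in> dyadic" "x \<in> dint I"
  obtain n k where n: "I = (n, k)" by (cases I)
  have "real k / 2 ^ n \<le> x" "x < (real k + 1) / 2 ^ n" using I n by (auto simp: dint_def)
  moreover have "real (k + 1) \<le> real (2 ^ n)" using I n unfolding dyadic_def of_nat_le_iff by simp
  then have "(real k + 1) / 2 ^ n \<le> 1" by (simp add: divide_simps)
  moreover have "0 \<le> real k / 2 ^ n" by simp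
  ultimately have "0 \<le> x" "x < 1" by linarith+
  then show "x \<in> dint (0, 0)" by (simp add: dint_def)
qed

lemma dstar_dyadic_fmeasurable: "L \<subseteq> dyadic \<Longrightarrow> dstar L \<in> fmeasurable lborel"
  by (rule dstar_fmeasurable[of _ "(0, 0)"]) (use dyadic_unit in \<open>auto simp: dsub_def\<close>)

text \<open>Test the condition on the maximal intervals of \<open>F\<close>: they are disjoint,
  contain every member of \<open>F\<close> and lie in \<open>dstar L\<close>. The bound matches the
  denominator of (b).\<close>

lemma packing_sum_le_dstar:
  assumes p: "packing L (\<lambda>_. 1) C" and F: "finite F" "F \<subseteq> L" and L: "L \<subseteq> dyadic" and C: "0 \<le> C"
  shows "(\<Sum>I\<in>F. dlen I) \<le> C * measure lborel (dstar L)"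
proof -
  have f: "finite (dmax F)" using F(1) by (rule finite_dmax)
  have "(\<Sum>I\<in>F. dlen I) \<le> (\<Sum>I\<in>(\<Union>J\<in>dmax F. {I \<in> F. dint I \<subseteq> dint J}). dlen I)"
  proof (rule sum_mono2)
    show "finite (\<Union>J\<in>dmax F. {I \<in> F. dint I \<subseteq> dint J})" using f F(1) by simp
    show "F \<subseteq> (\<Union>J\<in>dmax F. {I \<in> F. dint I \<subseteq> dint J})"
      using ex_dmax_above[of _ F] by fast
  qed simp
  also have "\<dots> \<le> (\<Sum>J\<in>dmax F. \<Sum>I\<in>{I \<in> F. dint I \<subseteq> dint J}. dlen I)"
    using f F by (intro sum_UN_le) auto
  also have "\<dots> \<le> (\<Sum>J\<in>dmax F. C * dlen J)"
  proof (rule sum_mono)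
    fix J assume "J \<in> dmax F"
    then have J: "J \<in> dyadic" using dmax_subset[of F] F(2) L by blast
    have "{I \<in> F. dint I \<subseteq> dint J} \<subseteq> dsub L J"
      using F(2) L by (auto simp: dsub_def)
    from packingD[OF p J _ this] F(1)
    show "(\<Sum>I\<in>{I \<in> F. dint I \<subseteq> dint J}. dlen I) \<le> C * dlen J" by simp
  qed
  also have "\<dots> = C * measure lborel (dstar F)"
    by (simp add: measure_dstar_finite F sum_distrib_left)
  also have "\<dots> \<le> C * measure lborel (dstar L)"
    by (rule mult_left_mono[OF measure_mono_fmeasurable[OF dstar_mono[OF F(2)] _ dstar_dyadic_fmeasurable[OF L]] C]) simp
  finally show ?thesis .
qed

text \<open>Exhaust \<open>L\<close> by its finite parts of bounded level and use continuity from
  below; \<open>X\<close> may be infinite.\<close>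

lemma emeasure_dstar_le:
  assumes L: "L \<subseteq> dyadic" and b: "\<And>F. finite F \<Longrightarrow> F \<subseteq> L \<Longrightarrow> (\<Sum>I\<in>F. ennreal (dlen I)) \<le> X"
  shows "emeasure lborel (dstar L) \<le> X"
proof -
  define D where "D n = {I \<in> L. fst I \<le> n}" for n
  have fin: "finite (D n)" for n
    by (rule finite_subset[OF _ finite_dyadic_level[of n]]) (use L in \<open>auto simp: D_def\<close>)
  have "dstar L = (\<Union>n. dstar (D n))"
    by (auto simp: dstar_def D_def)
  moreover have "(SUP n. emeasure lborel (dstar (D n))) = emeasure lborel (\<Union>n. dstar (D n))"
    by (intro SUP_emeasure_incseq) (auto simp: incseq_def D_def intro!: dstar_mono)
  moreover have "emeasure lborel (dstar (D n)) \<le> X" for n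
  proof -
    have "emeasure lborel (dstar (D n)) \<le> (\<Sum>I\<in>D n. emeasure lborel (dint I))"
      unfolding dstar_def using fin by (intro emeasure_subadditive_finite) auto
    also have "\<dots> \<le> X" unfolding emeasure_dint using fin by (intro b) (auto simp: D_def)
    finally show ?thesis .
  qed
  ultimately show ?thesis by (metis SUP_least)
qed

subsection \<open>Carleson weights as averages of Carleson collections\<close>

text \<open>Removing from each \<open>I\<close> what its proper descendants cover leaves disjoint
  sets, each with at least the share \<open>1 / c\<close> of \<open>dint I\<close>.\<close>

lemma packing_if_small_descendants:
  assumes c: "0 < c"
    and small: "\<And>F I. finite F \<Longrightarrow> F \<subseteq> L \<Longrightarrow> I \<in> F \<Longrightarrow>
      dlen I \<le> c * (dlen I - measure lborel (dstar {K \<in> F. dint K \<subset> dint I}))"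
  shows "packing L (\<lambda>_. 1) c"
  unfolding packing_def
proof (intro ballI allI impI)
  fix J F assume J: "J \<in> dyadic" and F: "finite F" "F \<subseteq> dsub L J"
  define U where "U I = dstar {K \<in> F. dint K \<subset> dint I}" for I
  have FL: "F \<subseteq> L" and FF: "F \<subseteq> dsub F J" using F(2) by (auto simp: dsub_def)
  have sub: "U I \<subseteq> dint I" for I by (auto simp: U_def dstar_def)
  have m: "measure lborel (dint I - U I) = dlen I - measure lborel (U I)" for I
    using sub[of I] by (subst measure_Diff) (auto simp: emeasure_dint U_def)
  have "packing F (\<lambda>_. 1) c"
  proof (rule packing_if_disjoint_parts[OF c])
    show "dlen I \<le> c * measure lborel (dint I - U I)" if "I \<in> F" for I
      using small[OF F(1) FL that] unfolding m by (simp add: U_def)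
    show "disjoint_family_on (\<lambda>I. dint I - U I) F"
      unfolding disjoint_family_on_def
    proof (intro ballI impI)
      fix I K assume IK: "I \<in> F" "K \<in> F" "I \<noteq> K"
      have "dint K \<subset> dint I \<Longrightarrow> dint K \<subseteq> U I" "dint I \<subset> dint K \<Longrightarrow> dint I \<subseteq> U K"
        using IK by (auto simp: U_def dstar_def)
      then show "(dint I - U I) \<inter> (dint K - U K) = {}"
        using IK(3) dint_inj[of I K] by (cases I K rule: dint_cases) blast+
    qed
  qed (auto simp: U_def)
  from packingD[OF this J F(1) FF]
  show "(\<Sum>I\<in>F. 1 * dlen I) \<le> c * dlen J" .
qed

section \<open>Slices of a weight along chains\<close>

definition anc_sum :: "(nat \<times> nat \<Rightarrow> real) \<Rightarrow> nat \<times> nat \<Rightarrow> real" where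
  "anc_sum w I = (\<Sum>Q\<in>{Q \<in> dyadic. dint I \<subset> dint Q}. w Q)"

lemma finite_dyadic_strict_super: "finite {Q \<in> dyadic. dint I \<subset> dint Q}"
  by (rule finite_subset[OF _ finite_dyadic_super[of I]]) auto

text \<open>The dyadic intervals containing \<open>K\<close> form a chain, which is cut at
  \<open>I\<close>.\<close>

lemma anc_sum_split:
  assumes K: "K \<in> dyadic" and sub: "dint K \<subset> dint I"
  shows "anc_sum w K + w K = anc_sum w I + (\<Sum>Q\<in>{Q \<in> dyadic. dint K \<subseteq> dint Q \<and> dint Q \<subseteq> dint I}. w Q)"
proof -
  let ?A = "{Q \<in> dyadic. dint I \<subset> dint Q}"
  let ?B = "{Q \<in> dyadic. dint K \<subseteq> dint Q \<and> dint Q \<subseteq> dint I}"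
  have f: "finite ?A" "finite ?B"
    using finite_dyadic_strict_super finite_subset[OF _ finite_dyadic_super[of K], of ?B] by auto
  have nest: "dint Q \<subseteq> dint I \<or> dint I \<subset> dint Q" if "dint K \<subseteq> dint Q" for Q
    using that sub dint_nonempty[of K] by (cases Q I rule: dint_cases) auto
  have "Q \<in> insert K {Q \<in> dyadic. dint K \<subset> dint Q} \<longleftrightarrow> Q \<in> ?A \<union> ?B" for Q
  proof (cases "Q = K")
    case False
    then have "dint K \<noteq> dint Q" using dint_inj by blast
    then show ?thesis using nest[of Q] sub False by auto
  qed (use K sub in auto)
  then have "insert K {Q \<in> dyadic. dint K \<subset> dint Q} = ?A \<union> ?B" by (intro set_eqI)
  then have "sum w (insert K {Q \<in> dyadic. dint K \<subset> dint Q}) = sum w (?A \<union> ?B)" by (rule arg_cong)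
  moreover have "sum w (insert K {Q \<in> dyadic. dint K \<subset> dint Q}) = anc_sum w K + w K"
    using finite_dyadic_strict_super[of K] by (simp add: anc_sum_def)
  moreover have "sum w (?A \<union> ?B) = sum w ?A + sum w ?B"
    using f by (intro sum.union_disjoint) auto
  ultimately show ?thesis by (simp add: anc_sum_def)
qed

text \<open>A weight is laid out along each chain of intervals: \<open>I\<close> occupies the segment of length \<open>w I\<close> that
  starts at \<open>anc_sum w I\<close>, and the slice picks the intervals whose segment meets \<open>t + 2\<int>\<close>. For
  \<open>w I \<le> 2\<close>, the set of \<open>t\<close> in \<open>[0, 2)\<close> with \<open>I\<close> in the slice has measure \<open>w I\<close>.\<close>

definition slice :: "(nat \<times> nat \<Rightarrow> real) \<Rightarrow> real \<Rightarrow> (nat \<times> nat) set" where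
  "slice w t = {I \<in> dyadic. \<exists>n::int. anc_sum w I < t + 2 * n \<and> t + 2 * n \<le> anc_sum w I + w I}"

text \<open>The segment of \<open>K\<close> starts no lower than that of \<open>I\<close> ends, so
  the points \<open>t + 2 * n\<close> and \<open>t + 2 * m\<close> in them differ by at least 2. The
  weights from \<open>K\<close> up to \<open>I\<close> span the distance.\<close>

lemma slice_sum_ge:
  assumes w: "\<And>I. 0 \<le> w I" and K: "K \<in> slice w t" and I: "I \<in> slice w t" and sub: "dint K \<subset> dint I"
  shows "2 \<le> (\<Sum>Q\<in>{Q \<in> dyadic. dint K \<subseteq> dint Q \<and> dint Q \<subseteq> dint I}. w Q)"
proof -
  obtain n :: int where n: "anc_sum w I < t + 2 * n" "t + 2 * n \<le> anc_sum w I + w I"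
    using I by (auto simp: slice_def)
  obtain m :: int where m: "anc_sum w K < t + 2 * m" "t + 2 * m \<le> anc_sum w K + w K"
    using K by (auto simp: slice_def)
  have dy: "K \<in> dyadic" "I \<in> dyadic" using K I by (auto simp: slice_def)
  have "anc_sum w I + w I = (\<Sum>Q\<in>insert I {Q \<in> dyadic. dint I \<subset> dint Q}. w Q)"
    using finite_dyadic_strict_super[of I] by (simp add: anc_sum_def)
  also have "\<dots> \<le> anc_sum w K"
    unfolding anc_sum_def using w finite_dyadic_strict_super[of K] dy sub
    by (intro sum_mono2) auto
  finally have "n < m" using n m by linarith
  then have "real_of_int n + 1 \<le> real_of_int m" by linarith
  then show ?thesis using anc_sum_split[OF dy(1) sub, of w] n m by linarith
qed

text \<open>Chebyshev's inequality: where a smaller slice interval lies below \<open>I\<close>, the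
  weights from there up to \<open>I\<close> add up to at least 2, while the integral of all weights
  below \<open>I\<close> is at most \<open>dlen I\<close>. So such intervals cover at most half of
  \<open>I\<close>.\<close>

lemma packing_slice:
  assumes w: "\<And>I. 0 \<le> w I" and p: "packing dyadic w 1"
  shows "packing (slice w t) (\<lambda>_. 1) 2"
proof (rule packing_if_small_descendants)
  fix F I assume F: "finite F" "F \<subseteq> slice w t" and I: "I \<in> F"
  define U where "U = dstar {K \<in> F. dint K \<subset> dint I}"
  \<comment> \<open>Finitely many intervals, so that packing applies, yet enough to contain every
    chain from a member of \<open>F\<close> up to \<open>I\<close>.\<close>
  define G where "G = {Q \<in> dyadic. dint Q \<subseteq> dint I \<and> (\<exists>K\<in>F. dint K \<subseteq> dint Q)}"
  have dy: "I \<in> dyadic" using F I by (auto simp: slice_def)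
  have "G \<subseteq> (\<Union>K\<in>F. {Q \<in> dyadic. dint K \<subseteq> dint Q})" by (auto simp: G_def)
  then have G: "finite G" by (rule finite_subset) (use F(1) finite_dyadic_super in blast)
  have UI: "U \<subseteq> dint I" by (auto simp: U_def dstar_def)
  have fm: "U \<in> fmeasurable lborel"
    by (rule fmeasurableI2[OF dint_fmeasurable[of I] UI]) (simp add: U_def)
  have "2 * measure lborel U = (\<integral>x. 2 * indicat_real U x \<partial>lborel)"
    by (simp add: U_def)
  also have "\<dots> \<le> (\<integral>x. (\<Sum>Q\<in>G. w Q * indicat_real (dint Q) x) \<partial>lborel)"
  proof (rule integral_mono)
    show "integrable lborel (\<lambda>x. 2 * indicat_real U x)"
      using fm by (auto intro!: integrable_real_indicator simp: fmeasurable_def)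
    show "integrable lborel (\<lambda>x. \<Sum>Q\<in>G. w Q * indicat_real (dint Q) x)"
      by (auto intro!: integrable_real_indicator Bochner_Integration.integrable_sum integrable_mult_right
          simp: emeasure_dint)
    fix x
    show "2 * indicat_real U x \<le> (\<Sum>Q\<in>G. w Q * indicat_real (dint Q) x)"
    proof (cases "x \<in> U")
      case True
      then obtain K where K: "K \<in> F" "dint K \<subset> dint I" "x \<in> dint K" by (auto simp: U_def dstar_def)
      let ?B = "{Q \<in> dyadic. dint K \<subseteq> dint Q \<and> dint Q \<subseteq> dint I}"
      have "2 \<le> (\<Sum>Q\<in>?B. w Q)" using slice_sum_ge[of w K t I, OF w] K I F(2) by blast
      also have "\<dots> = (\<Sum>Q\<in>?B. w Q * indicat_real (dint Q) x)"
        using K(3) by (intro sum.cong) auto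
      also have "\<dots> \<le> (\<Sum>Q\<in>G. w Q * indicat_real (dint Q) x)"
        using w G K(1) by (intro sum_mono2) (auto simp: G_def)
      finally show ?thesis using True by simp
    qed (simp add: w sum_nonneg)
  qed
  also have "\<dots> = (\<Sum>Q\<in>G. w Q * dlen Q)"
    by (subst Bochner_Integration.integral_sum)
       (auto intro!: integrable_real_indicator integrable_mult_right simp: emeasure_dint)
  also have "\<dots> \<le> 1 * dlen I"
    by (rule packingD[OF p dy G]) (auto simp: G_def dsub_def)
  finally show "dlen I \<le> 2 * (dlen I - measure lborel (dstar {K \<in> F. dint K \<subset> dint I}))"
    unfolding U_def by simp
qed simp

text \<open>\<open>S\<close> is the half-open interval from \<open>p\<close> to \<open>p + b\<close>
  taken modulo 2; it does not overlap itself because \<open>b \<le> 2\<close>.\<close>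

lemma measure_translates_ge:
  fixes p b :: real
  assumes b: "0 \<le> b" "b \<le> 2"
  defines "S \<equiv> {t \<in> {0..<2}. \<exists>n::int. p < t + 2 * n \<and> t + 2 * n \<le> p + b}"
  shows "S \<in> fmeasurable lborel" "b \<le> measure lborel S"
proof -
  have "S = (\<Union>n::int. {0..<2} \<inter> {p - 2 * n<..p + b - 2 * n})"
    by (auto simp: S_def algebra_simps)
  then have S: "S \<in> sets lborel" by simp
  have "{0..2::real} \<in> fmeasurable lborel" by (simp add: fmeasurable_def)
  then show fm: "S \<in> fmeasurable lborel" by (rule fmeasurableI2[OF _ _ S]) (auto simp: S_def)
  \<comment> \<open>Shifting by a multiple of 2 moves the starting point \<open>p\<close> to
    \<open>q\<close> in [0, 2).\<close>
  define n where "n = \<lfloor>p / 2\<rfloor>"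
  define q where "q = p - 2 * n"
  have q: "0 \<le> q" "q < 2" unfolding q_def n_def by linarith+
  have p: "p = q + 2 * n" by (simp add: q_def)
  have mem: "t \<in> S" if "0 \<le> t" "t < 2" "q < t + 2 * k" "t + 2 * k \<le> q + b" for t :: real and k :: int
    using that unfolding S_def p by (auto intro!: exI[of _ "n + k"])
  show "b \<le> measure lborel S"
  proof (cases "q + b < 2")
    case True
    have "{q<..q + b} \<subseteq> S" using True q mem[of _ 0] by auto
    from measure_mono_fmeasurable[OF this _ fm] show ?thesis using b by simp
  next
    \<comment> \<open>The interval passes the end of [0, 2): one piece reaches up to 2, the rest
      reappears at 0. They are disjoint because \<open>b \<le> 2\<close>.\<close>
    case False
    have "t \<in> S" if "t \<in> {q<..<2}" for t
      using that False q mem[of t 0] by simp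
    moreover have "t \<in> S" if "t \<in> {0..q + b - 2}" for t
      using that False q b mem[of t 1] by simp
    ultimately have "{q<..<2} \<union> {0..q + b - 2} \<subseteq> S" by blast
    from measure_mono_fmeasurable[OF this _ fm]
    have "measure lborel ({q<..<2} \<union> {0..q + b - 2}) \<le> measure lborel S" by simp
    also have "measure lborel ({q<..<2} \<union> {0..q + b - 2}) = measure lborel {q<..<2} + measure lborel {0..q + b - 2}"
      using b q False by (intro measure_Union) auto
    finally show ?thesis using q b False by simp
  qed
qed

text \<open>Average the hypothesis over all slices: \<open>I\<close> is in the slice for a set of
  \<open>t\<close> of measure at least \<open>w I\<close>, each slice contributes at most
  \<open>C * dlen J\<close>, and 2 is the length of the range of \<open>t\<close>.\<close>

lemma packing_transfer:
  assumes \<tau>: "rearrangement \<tau>" and C: "0 \<le> C"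
    and H: "\<And>L. L \<subseteq> dyadic \<Longrightarrow> packing L (\<lambda>_. 1) 2 \<Longrightarrow> packing (\<tau> ` L) (\<lambda>_. 1) C"
    and w: "\<And>I. 0 \<le> w I" and p: "packing dyadic w 1"
    and J: "J \<in> dyadic" and F: "finite F" "F \<subseteq> dyadic" "\<tau> ` F \<subseteq> dsub dyadic J"
  shows "(\<Sum>I\<in>F. w I * dlen (\<tau> I)) \<le> 2 * C * dlen J"
proof -
  define S where "S I = {t \<in> {0..<2}. \<exists>n::int. anc_sum w I < t + 2 * n \<and> t + 2 * n \<le> anc_sum w I + w I}" for I
  \<comment> \<open>Packing tested on a single interval; \<open>measure_translates_ge\<close> needs
    weights of at most 2.\<close>
  have w1: "w I \<le> 2" if "I \<in> F" for I
  proof -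
    have "I \<in> dyadic" using that F by auto
    from packingD[OF p this, of "{I}"] this have "w I * dlen I \<le> 1 * dlen I" by (simp add: dsub_def)
    then have "w I \<le> 1" by (rule mult_right_le_imp_le) simp
    then show ?thesis by simp
  qed
  have fm: "S I \<in> fmeasurable lborel" and ge: "w I \<le> measure lborel (S I)" if "I \<in> F" for I
    unfolding S_def using measure_translates_ge[of "w I", OF w w1[OF that]] by blast+
  have int: "integrable lborel (\<lambda>t. dlen (\<tau> I) * indicat_real (S I) t)" if "I \<in> F" for I
    using fm[OF that] by (auto intro!: integrable_real_indicator simp: fmeasurable_def)
  have "(\<Sum>I\<in>F. w I * dlen (\<tau> I)) \<le> (\<Sum>I\<in>F. dlen (\<tau> I) * measure lborel (S I))"
    using ge by (intro sum_mono) (simp add: mult.commute mult_left_mono)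
  also have "\<dots> = (\<Sum>I\<in>F. \<integral>t. dlen (\<tau> I) * indicat_real (S I) t \<partial>lborel)"
    by (intro sum.cong) (use fm in \<open>auto simp: fmeasurable_def\<close>)
  also have "\<dots> = (\<integral>t. (\<Sum>I\<in>F. dlen (\<tau> I) * indicat_real (S I) t) \<partial>lborel)"
    by (rule Bochner_Integration.integral_sum[symmetric]) (rule int)
  also have "\<dots> \<le> (\<integral>t. C * dlen J * indicat_real {0..<2::real} t \<partial>lborel)"
  proof (rule integral_mono)
    show "integrable lborel (\<lambda>t. \<Sum>I\<in>F. dlen (\<tau> I) * indicat_real (S I) t)"
      by (rule Bochner_Integration.integrable_sum) (rule int)
    show "integrable lborel (\<lambda>t. C * dlen J * indicat_real {0..<2::real} t)"
      by (auto intro!: integrable_real_indicator)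
    fix t
    show "(\<Sum>I\<in>F. dlen (\<tau> I) * indicat_real (S I) t) \<le> C * dlen J * indicat_real {0..<2::real} t"
    proof (cases "t \<in> {0..<2}")
      case True
      let ?G = "F \<inter> slice w t"
      have inj: "inj_on \<tau> ?G"
        using \<tau> F(2) unfolding rearrangement_def by (blast intro: inj_on_subset)
      have pk: "packing (\<tau> ` slice w t) (\<lambda>_. 1) C"
        by (rule H[OF _ packing_slice[of w, OF w p]]) (auto simp: slice_def)
      have "(\<Sum>I\<in>F. dlen (\<tau> I) * indicat_real (S I) t) = (\<Sum>I\<in>?G. dlen (\<tau> I))"
        using F True
        by (intro sum.mono_neutral_cong_right) (auto simp: S_def slice_def indicator_def)
      also have "\<dots> = (\<Sum>K\<in>\<tau> ` ?G. dlen K)" by (simp add: sum.reindex[OF inj])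
      also have "\<dots> \<le> C * dlen J"
        using packingD[OF pk J, of "\<tau> ` ?G"] F by (auto simp: dsub_def)
      finally show ?thesis using True by simp
    next
      case False
      then have "t \<notin> S I" for I by (auto simp: S_def)
      then show ?thesis using C by simp
    qed
  qed
  also have "\<dots> = 2 * C * dlen J" by simp
  finally show ?thesis .
qed

subsection \<open>Consequences of weak-Property P and of boundedness on BMO\<close>

lemma rinv_apply [simp]: "rearrangement \<tau> \<Longrightarrow> I \<in> dyadic \<Longrightarrow> rinv \<tau> (\<tau> I) = I"
  by (simp add: rinv_def rearrangement_def the_inv_into_f_f)

lemma rearrangement_inj: "rearrangement \<tau> \<Longrightarrow> L \<subseteq> dyadic \<Longrightarrow> inj_on \<tau> L"
  unfolding rearrangement_def by (blast intro: inj_on_subset)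

lemma rearrangement_mem: "rearrangement \<tau> \<Longrightarrow> I \<in> dyadic \<Longrightarrow> \<tau> I \<in> dyadic"
  unfolding rearrangement_def by blast

lemma sum_le_infsum_ennreal:
  fixes f :: "'a \<Rightarrow> ennreal"
  shows "finite F \<Longrightarrow> F \<subseteq> A \<Longrightarrow> sum f F \<le> infsum f A"
  by (subst nonneg_infsum_complete) (auto intro: SUP_upper)

text \<open>Each \<open>E i\<close> may be infinite, so lengths are summed in
  \<open>ennreal\<close>; disjointness merges them into one sum over the union, whose finite subsums
  are at most \<open>X\<close>.\<close>

lemma sum_measure_dstar_le:
  assumes N: "finite N" and disj: "disjoint_family_on E N" and E: "\<And>i. E i \<subseteq> dyadic" and X: "0 \<le> X"
    and b: "\<And>F. finite F \<Longrightarrow> F \<subseteq> (\<Union>i. E i) \<Longrightarrow> (\<Sum>I\<in>F. dlen I) \<le> X"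
  shows "(\<Sum>i\<in>N. measure lborel (dstar (E i))) \<le> X"
proof -
  have "(\<Sum>i\<in>N. emeasure lborel (dstar (E i))) \<le> (\<Sum>i\<in>N. \<Sum>\<^sub>\<infinity>I\<in>E i. ennreal (dlen I))"
    by (intro sum_mono emeasure_dstar_le[OF E]) (rule sum_le_infsum_ennreal)
  also have "\<dots> = (\<Sum>\<^sub>\<infinity>I\<in>(\<Union>i\<in>N. E i). ennreal (dlen I))"
    using N disj
  proof (induction rule: finite_induct)
    case (insert i N)
    have "E i \<inter> (\<Union>j\<in>N. E j) = {}"
      using insert.prems insert.hyps(2) by (fastforce simp: disjoint_family_on_def)
    then have "(\<Sum>\<^sub>\<infinity>I\<in>(\<Union>j\<in>insert i N. E j). ennreal (dlen I)) =
        (\<Sum>\<^sub>\<infinity>I\<in>E i. ennreal (dlen I)) + (\<Sum>\<^sub>\<infinity>I\<in>(\<Union>j\<in>N. E j). ennreal (dlen I))"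
      by (simp add: infsum_Un_disjoint nonneg_summable_on_complete)
    moreover have "disjoint_family_on E N"
      using insert.prems by (rule disjoint_family_on_mono[rotated]) auto
    ultimately show ?case using insert by simp
  qed simp
  also have "\<dots> \<le> ennreal X"
  proof (subst nonneg_infsum_complete)
    show "(SUP F\<in>{F. finite F \<and> F \<subseteq> (\<Union>i\<in>N. E i)}. \<Sum>I\<in>F. ennreal (dlen I)) \<le> ennreal X"
    proof (rule SUP_least)
      fix F assume "F \<in> {F. finite F \<and> F \<subseteq> (\<Union>i\<in>N. E i)}"
      then have "finite F" "F \<subseteq> (\<Union>i. E i)" by auto
      from b[OF this] show "(\<Sum>I\<in>F. ennreal (dlen I)) \<le> ennreal X"
        by (simp add: sum_ennreal X)
    qed
  qed simp
  also have "(\<Sum>i\<in>N. emeasure lborel (dstar (E i))) = ennreal (\<Sum>i\<in>N. measure lborel (dstar (E i)))"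
    using dstar_dyadic_fmeasurable[OF E]
    by (simp add: emeasure_eq_measure2 sum_ennreal)
  finally show ?thesis using X by simp
qed

text \<open>The body of \<open>weak_property_P\<close> for fixed \<open>M\<close>, \<open>B\<close>,
  \<open>J\<close> and fixed collections, named so that its clauses can be used one at a
  time.\<close>

definition P_decomposition ::
  "(nat \<times> nat \<Rightarrow> nat \<times> nat) \<Rightarrow> real \<Rightarrow> (nat \<times> nat) set \<Rightarrow> nat \<times> nat \<Rightarrow>
    (nat \<Rightarrow> (nat \<times> nat) set) \<Rightarrow> (nat \<Rightarrow> (nat \<times> nat) set) \<Rightarrow> bool" where
  "P_decomposition \<tau> M B J L E \<longleftrightarrow>
     (\<forall>i. L i \<subseteq> dyadic \<and> E i \<subseteq> dyadic) \<and>
     dsub (\<tau> ` B) J = (\<Union>i. \<tau> ` L i) \<union> (\<Union>i. E i) \<and>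
     (\<forall>i j. i \<noteq> j \<longrightarrow> \<tau> ` L i \<inter> \<tau> ` L j = {} \<and> E i \<inter> E j = {}) \<and>
     (\<forall>i j. \<tau> ` L i \<inter> E j = {}) \<and>
     carleson (\<Union>i. E i) \<le> ennreal M \<and>
     (\<forall>i. \<forall>I\<in>L i. dlen (\<tau> I) / dlen I \<le>
         M * (measure lborel (dstar (\<tau> ` L i)) + measure lborel (dstar (E i)))
           / measure lborel (dstar (L i))) \<and>
     (\<Sum>i. ennreal (measure lborel (dstar (\<tau> ` L i))))
        \<le> ennreal (M * dlen J) * (SUP i. carleson (rinv \<tau> ` dmax (\<tau> ` L i)))"

lemma weak_property_P_iff:
  "weak_property_P \<tau> \<longleftrightarrow> (\<exists>M>0. \<forall>B\<subseteq>dyadic. \<forall>J\<in>dyadic. \<exists>L E. P_decomposition \<tau> M B J L E)"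
  unfolding weak_property_P_def P_decomposition_def by (rule refl)

lemma weak_property_P_imp_packing:
  assumes \<tau>: "rearrangement \<tau>" and P: "weak_property_P \<tau>"
  shows "\<exists>C\<ge>0. \<forall>L\<subseteq>dyadic. packing L (\<lambda>_. 1) 2 \<longrightarrow> packing (\<tau> ` L) (\<lambda>_. 1) C"
proof -
  from P[unfolded weak_property_P_iff] obtain M where M: "0 < M"
    and dec: "\<forall>B\<subseteq>dyadic. \<forall>J\<in>dyadic. \<exists>L E. P_decomposition \<tau> M B J L E"
    by (elim exE conjE) (rule that)
  show ?thesis
  \<comment> \<open>Summing (b) with packing constant 2 gives the factor \<open>2 * M\<close>; the
    measures on its right side total at most \<open>(2 * M + M) * dlen J\<close> by (c) and (a). The
    exceptional intervals themselves add \<open>M\<close>.\<close>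
  proof (intro exI[of _ "6 * M ^ 2 + M"] conjI allI impI)
    show "0 \<le> 6 * M ^ 2 + M" using M by simp
    fix L assume L: "L \<subseteq> dyadic" and pL: "packing L (\<lambda>_. 1) 2"
    show "packing (\<tau> ` L) (\<lambda>_. 1) (6 * M ^ 2 + M)"
      unfolding packing_def
    proof (intro ballI allI impI)
      fix J F assume J: "J \<in> dyadic" and F: "finite F" "F \<subseteq> dsub (\<tau> ` L) J"
      from dec L J obtain A E where D: "P_decomposition \<tau> M L J A E" by blast
      have AE: "A i \<subseteq> dyadic" "E i \<subseteq> dyadic" for i
        using D unfolding P_decomposition_def by blast+
      have cover: "dsub (\<tau> ` L) J = (\<Union>i. \<tau> ` A i) \<union> (\<Union>i. E i)"
        using D unfolding P_decomposition_def by (elim conjE)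
      have disj: "E i \<inter> E j = {}" if "i \<noteq> j" for i j
        using D that unfolding P_decomposition_def by (elim conjE) simp
      have carl: "carleson (\<Union>i. E i) \<le> ennreal M"
        using D unfolding P_decomposition_def by (elim conjE)
      have ratio: "\<forall>i. \<forall>I\<in>A i. dlen (\<tau> I) / dlen I \<le>
           M * (measure lborel (dstar (\<tau> ` A i)) + measure lborel (dstar (E i)))
             / measure lborel (dstar (A i))"
        using D unfolding P_decomposition_def by (elim conjE)
      have total: "(\<Sum>i. ennreal (measure lborel (dstar (\<tau> ` A i))))
          \<le> ennreal (M * dlen J) * (SUP i. carleson (rinv \<tau> ` dmax (\<tau> ` A i)))"
        using D unfolding P_decomposition_def by (elim conjE)
      define t where "t i = measure lborel (dstar (\<tau> ` A i))" for i
      define e where "e i = measure lborel (dstar (E i))" for i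
      have te: "0 \<le> t i" "0 \<le> e i" for i by (auto simp: t_def e_def)
      have AL: "A i \<subseteq> L" for i
      proof
        fix I assume I: "I \<in> A i"
        then have "\<tau> I \<in> dsub (\<tau> ` L) J" unfolding cover by blast
        then obtain K where K: "K \<in> L" "\<tau> I = \<tau> K" by (auto simp: dsub_def)
        then have "I = K" using rearrangement_inj[OF \<tau> subset_refl] I AE(1) L by (blast dest: inj_onD)
        then show "I \<in> L" using K by simp
      qed
      \<comment> \<open>By the covering identity the exceptional intervals lie below
        \<open>J\<close>, so (a) can be tested on \<open>J\<close>.\<close>
      have EJ: "F' \<subseteq> dsub (\<Union>i. E i) J" if "F' \<subseteq> (\<Union>i. E i)" for F'
      proof -
        have "F' \<subseteq> dsub (\<tau> ` L) J" using that cover by blast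
        then show ?thesis using that by (auto simp: dsub_def)
      qed
      have pE: "(\<Sum>I\<in>F'. dlen I) \<le> M * dlen J" if "finite F'" "F' \<subseteq> (\<Union>i. E i)" for F'
        using packingD[OF _ J that(1) EJ[OF that(2)], of "\<lambda>_. 1" M] carl M by (simp add: carleson_le_iff)
      \<comment> \<open>All ratios in a group share one bound, whose denominator cancels against the
        Carleson bound for the lengths of the group. An empty \<open>G\<close> is set apart because
        the denominator must be positive.\<close>
      have piece: "(\<Sum>K\<in>F \<inter> \<tau> ` A i. dlen K) \<le> 2 * M * (t i + e i)" for i
      proof -
        define G where "G = {I \<in> A i. \<tau> I \<in> F}"
        have img: "F \<inter> \<tau> ` A i = \<tau> ` G" by (auto simp: G_def)
        have inj: "inj_on \<tau> G" using rearrangement_inj[OF \<tau>, of G] AE(1)[of i] by (auto simp: G_def)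
        have G: "finite G" using finite_imageD[OF _ inj] F(1) img by (metis finite_Int)
        have GA: "G \<subseteq> A i" by (auto simp: G_def)
        have sm: "(\<Sum>K\<in>F \<inter> \<tau> ` A i. dlen K) = (\<Sum>I\<in>G. dlen (\<tau> I))"
          unfolding img by (simp add: sum.reindex[OF inj])
        show ?thesis
        proof (cases "G = {}")
          case True
          then show ?thesis using sm te M by simp
        next
          case False
          then obtain I0 where I0: "I0 \<in> A i" using GA by blast
          define m where "m = measure lborel (dstar (A i))"
          have "dlen I0 \<le> m"
            using measure_mono_fmeasurable[of "dint I0" "dstar (A i)" lborel] I0
              dstar_dyadic_fmeasurable[OF AE(1)[of i]]
            by (auto simp: m_def dstar_def)
          then have m: "0 < m" using dlen_pos[of I0] by linarith
          have "(\<Sum>I\<in>G. dlen (\<tau> I)) \<le> (\<Sum>I\<in>G. M * (t i + e i) / m * dlen I)"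
          proof (rule sum_mono)
            fix I assume "I \<in> G"
            then have "dlen (\<tau> I) / dlen I \<le> M * (t i + e i) / m"
              using ratio GA unfolding t_def e_def m_def by blast
            then show "dlen (\<tau> I) \<le> M * (t i + e i) / m * dlen I"
              by (subst (asm) pos_divide_le_eq) auto
          qed
          also have "\<dots> = M * (t i + e i) / m * (\<Sum>I\<in>G. dlen I)"
            by (simp add: sum_distrib_left)
          also have "\<dots> \<le> M * (t i + e i) / m * (2 * m)"
            unfolding m_def using M te packing_sum_le_dstar[OF packing_subset[OF pL AL] G GA AE(1)]
            by (intro mult_left_mono) auto
          also have "\<dots> = 2 * M * (t i + e i)" using m by simp
          finally show ?thesis using sm by simp
        qed
      qed
      \<comment> \<open>A finite \<open>F\<close> needs only finitely many groups. For a
        \<open>K\<close> outside all groups the index is arbitrary and harmless.\<close>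
      define ix where "ix K = (SOME i. K \<in> \<tau> ` A i)" for K
      define N where "N = ix ` F"
      have N: "finite N" using F by (simp add: N_def)
      have FN: "F \<subseteq> (\<Union>i\<in>N. F \<inter> \<tau> ` A i) \<union> (F \<inter> (\<Union>i. E i))"
      proof
        fix K assume K: "K \<in> F"
        then have "K \<in> (\<Union>i. \<tau> ` A i) \<union> (\<Union>i. E i)" using F(2) cover by blast
        then show "K \<in> (\<Union>i\<in>N. F \<inter> \<tau> ` A i) \<union> (F \<inter> (\<Union>i. E i))"
        proof
          assume "K \<in> (\<Union>i. \<tau> ` A i)"
          then obtain i where "K \<in> \<tau> ` A i" by blast
          then have "K \<in> \<tau> ` A (ix K)" unfolding ix_def by (rule someI)
          then have "K \<in> (\<Union>i\<in>N. F \<inter> \<tau> ` A i)"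
            using K unfolding N_def by (intro UN_I[of "ix K"]) simp_all
          then show ?thesis by (rule UnI1)
        qed (use K in simp)
      qed
      have tot: "(\<Sum>i\<in>N. t i) \<le> 2 * M * dlen J"
      proof -
        \<comment> \<open>The preimages of the maximal images form a subcollection of
          \<open>L\<close>, so the supremum in (c) is at most 2.\<close>
        have "carleson (rinv \<tau> ` dmax (\<tau> ` A i)) \<le> ennreal 2" for i
        proof -
          have "rinv \<tau> ` dmax (\<tau> ` A i) \<subseteq> rinv \<tau> ` \<tau> ` A i"
            using dmax_subset by (intro image_mono)
          also have "\<dots> = A i"
          proof -
            have "rinv \<tau> (\<tau> I) = I" if "I \<in> A i" for I
              using subsetD[OF AE(1) that] \<tau> by simp
            then show ?thesis by (simp add: image_image)
          qed
          also note AL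
          finally show ?thesis using packing_subset[OF pL] by (subst carleson_le_iff) auto
        qed
        then have Z: "(SUP i. carleson (rinv \<tau> ` dmax (\<tau> ` A i))) \<le> ennreal 2" by (intro SUP_least)
        have "ennreal (\<Sum>i\<in>N. t i) = (\<Sum>i\<in>N. ennreal (t i))" by (simp add: sum_ennreal te)
        also have "\<dots> \<le> (\<Sum>i. ennreal (t i))" using N by (intro sum_le_suminf) auto
        also have "\<dots> \<le> ennreal (M * dlen J) * ennreal 2"
          using total Z unfolding t_def by (meson mult_left_mono order_trans zero_le)
        also have "\<dots> = ennreal (M * dlen J * 2)" using M by (intro ennreal_mult[symmetric]) auto
        finally show ?thesis using M by simp
      qed
      have ee: "(\<Sum>i\<in>N. e i) \<le> M * dlen J"
        unfolding e_def using disj M pE AE(2)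
        by (intro sum_measure_dstar_le[OF N]) (auto simp: disjoint_family_on_def)
      have "(\<Sum>K\<in>F. dlen K) \<le> (\<Sum>K\<in>(\<Union>i\<in>N. F \<inter> \<tau> ` A i) \<union> (F \<inter> (\<Union>i. E i)). dlen K)"
        using F(1) N by (intro sum_mono2 FN) auto
      also have "\<dots> \<le> (\<Sum>K\<in>(\<Union>i\<in>N. F \<inter> \<tau> ` A i). dlen K) + (\<Sum>K\<in>F \<inter> (\<Union>i. E i). dlen K)"
        using F(1) N by (subst sum_Un) (auto intro: sum_nonneg)
      also have "\<dots> \<le> (\<Sum>i\<in>N. \<Sum>K\<in>F \<inter> \<tau> ` A i. dlen K) + M * dlen J"
        using F(1) N by (intro add_mono sum_UN_le pE) auto
      also have "\<dots> \<le> (\<Sum>i\<in>N. 2 * M * (t i + e i)) + M * dlen J"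
        by (intro add_mono sum_mono piece) simp
      also have "\<dots> = 2 * M * ((\<Sum>i\<in>N. t i) + (\<Sum>i\<in>N. e i)) + M * dlen J"
        by (simp add: sum_distrib_left[symmetric] sum.distrib)
      also have "\<dots> \<le> 2 * M * (2 * M * dlen J + M * dlen J) + M * dlen J"
        using M tot ee by (intro add_mono mult_left_mono) auto
      also have "\<dots> = (6 * M ^ 2 + M) * dlen J"
        by (simp add: algebra_simps power2_eq_square)
      finally show "(\<Sum>K\<in>F. 1 * dlen K) \<le> (6 * M ^ 2 + M) * dlen J" by simp
    qed
  qed
qed

text \<open>The operator moves the squared coefficient of \<open>I\<close> to
  \<open>\<tau> I\<close>, so this is \<open>packing_transfer\<close> for the normalized weight. The
  factor \<open>2 * C\<close> bounds squared norms, hence the root.\<close>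

lemma packing_imp_BMO_bounded:
  assumes \<tau>: "rearrangement \<tau>" and C: "0 \<le> C"
    and H: "\<And>L. L \<subseteq> dyadic \<Longrightarrow> packing L (\<lambda>_. 1) 2 \<Longrightarrow> packing (\<tau> ` L) (\<lambda>_. 1) C"
  shows "BMO_bounded \<tau>"
  unfolding BMO_bounded_def
proof (intro exI[of _ "sqrt (2 * C)"] allI impI)
  fix x assume x: "in_BMO x"
  define \<Lambda> where "\<Lambda> = enn2real (bmo_sq x)"
  have \<Lambda>: "0 \<le> \<Lambda>" "bmo_sq x = ennreal \<Lambda>" using x by (auto simp: \<Lambda>_def in_BMO_def)
  then have p: "packing dyadic (\<lambda>I. (x I)\<^sup>2) \<Lambda>" using bmo_sq_le_iff[of \<Lambda> x] by simp
  have "packing dyadic (\<lambda>K. (Top \<tau> x K)\<^sup>2) (2 * C * \<Lambda>)"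
    unfolding packing_def
  proof (intro ballI allI impI)
    fix J F assume J: "J \<in> dyadic" and F: "finite F" "F \<subseteq> dsub dyadic J"
    \<comment> \<open>Coefficients outside the range of \<open>\<tau>\<close> vanish, so only the
      preimage of \<open>F\<close> matters.\<close>
    define G where "G = {I \<in> dyadic. \<tau> I \<in> F}"
    have img: "F \<inter> \<tau> ` dyadic = \<tau> ` G" by (auto simp: G_def)
    have Gd: "G \<subseteq> dyadic" by (auto simp: G_def)
    have inj: "inj_on \<tau> G" using rearrangement_inj[OF \<tau> Gd] .
    have G: "finite G" using finite_imageD[OF _ inj] F(1) img by (metis finite_Int)
    have "(\<Sum>K\<in>F. (Top \<tau> x K)\<^sup>2 * dlen K) = (\<Sum>K\<in>\<tau> ` G. (Top \<tau> x K)\<^sup>2 * dlen K)"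
      unfolding img[symmetric] using F(1)
      by (intro sum.mono_neutral_right) (auto simp: Top_def)
    also have "\<dots> = (\<Sum>I\<in>G. (Top \<tau> x (\<tau> I))\<^sup>2 * dlen (\<tau> I))" by (simp add: sum.reindex[OF inj])
    also have "\<dots> = (\<Sum>I\<in>G. (x I)\<^sup>2 * dlen (\<tau> I))"
    proof (rule sum.cong[OF refl])
      fix I assume "I \<in> G"
      then have "I \<in> dyadic" using Gd by blast
      then show "(Top \<tau> x (\<tau> I))\<^sup>2 * dlen (\<tau> I) = (x I)\<^sup>2 * dlen (\<tau> I)"
        using \<tau> by (simp add: Top_def)
    qed
    also have "\<dots> \<le> 2 * C * \<Lambda> * dlen J"
    proof (cases "\<Lambda> = 0")
      \<comment> \<open>A zero norm cannot be normalized; tests on single intervals then force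
        \<open>x I = 0\<close>.\<close>
      case True
      have "(x I)\<^sup>2 * dlen I \<le> 0" if "I \<in> dyadic" for I
        using packingD[OF p that, of "{I}"] that True by (simp add: dsub_def)
      then have "x I = 0" if "I \<in> dyadic" for I using that by (simp add: mult_le_0_iff not_le)
      then show ?thesis using Gd True by (auto intro!: sum_nonpos)
    next
      case False
      then have pos: "0 < \<Lambda>" using \<Lambda> by simp
      have "packing dyadic (\<lambda>I. (x I)\<^sup>2 / \<Lambda>) 1"
        using p pos unfolding packing_def
        by (simp add: sum_divide_distrib[symmetric] pos_divide_le_eq mult.commute)
      then have "(\<Sum>I\<in>G. (x I)\<^sup>2 / \<Lambda> * dlen (\<tau> I)) \<le> 2 * C * dlen J"
        using pos G Gd F(2) img
        by (intro packing_transfer[OF \<tau> C H _ _ J]) (auto simp: G_def)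
      moreover have "(\<Sum>I\<in>G. (x I)\<^sup>2 / \<Lambda> * dlen (\<tau> I)) = (\<Sum>I\<in>G. (x I)\<^sup>2 * dlen (\<tau> I)) / \<Lambda>"
        by (simp add: sum_divide_distrib)
      ultimately show ?thesis using pos by (simp add: pos_divide_le_eq algebra_simps)
    qed
    finally show "(\<Sum>K\<in>F. (Top \<tau> x K)\<^sup>2 * dlen K) \<le> 2 * C * \<Lambda> * dlen J" .
  qed
  then have le: "bmo_sq (Top \<tau> x) \<le> ennreal (2 * C * \<Lambda>)"
    using C \<Lambda>(1) by (subst bmo_sq_le_iff) auto
  then have "in_BMO (Top \<tau> x)" by (simp add: in_BMO_def le_less_trans)
  moreover have "enn2real (bmo_sq (Top \<tau> x)) \<le> 2 * C * \<Lambda>"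
    using le C \<Lambda>(1) by (intro enn2real_leI) auto
  then have "bmo_norm (Top \<tau> x) \<le> sqrt (2 * C) * bmo_norm x"
    unfolding bmo_norm_def \<Lambda>_def real_sqrt_mult[symmetric] by (rule real_sqrt_le_mono)
  ultimately show "in_BMO (Top \<tau> x) \<and> bmo_norm (Top \<tau> x) \<le> sqrt (2 * C) * bmo_norm x" by blast
qed

section \<open>Indicator sequences and Carleson constants\<close>

lemma bmo_sq_indicator:
  assumes "L \<subseteq> dyadic" shows "bmo_sq (indicator L) = carleson L"
proof -
  have "(\<Sum>\<^sub>\<infinity>I\<in>dsub dyadic J. ennreal ((indicator L I)\<^sup>2 * dlen I)) = (\<Sum>\<^sub>\<infinity>I\<in>dsub L J. ennreal (dlen I))" for J
    using assms by (intro infsum_cong_neutral) (auto simp: dsub_def indicator_def)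
  then show ?thesis by (simp add: bmo_sq_def carleson_def)
qed

lemma Top_indicator:
  assumes \<tau>: "rearrangement \<tau>" and L: "L \<subseteq> dyadic"
  shows "Top \<tau> (indicator L) = indicator (\<tau> ` L)"
proof
  fix K
  show "Top \<tau> (indicator L) K = indicator (\<tau> ` L) K"
  proof (cases "K \<in> \<tau> ` dyadic")
    case True
    then obtain I where I: "I \<in> dyadic" "K = \<tau> I" by blast
    have "\<tau> I \<in> \<tau> ` L \<longleftrightarrow> I \<in> L"
      using inj_on_image_mem_iff[OF rearrangement_inj[OF \<tau> subset_refl] I(1) L] .
    then show ?thesis using I \<tau> by (simp add: Top_def indicator_def)
  next
    case False
    then show ?thesis using L by (auto simp: Top_def indicator_def)
  qed
qed

lemma BMO_bounded_imp_carleson_le: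
  assumes \<tau>: "rearrangement \<tau>" and T: "BMO_bounded \<tau>"
  shows "\<exists>M::real\<ge>1. \<forall>L\<subseteq>dyadic. carleson (\<tau> ` L) \<le> ennreal M * carleson L"
proof -
  from T obtain C where C: "\<And>x. in_BMO x \<Longrightarrow> in_BMO (Top \<tau> x) \<and> bmo_norm (Top \<tau> x) \<le> C * bmo_norm x"
    unfolding BMO_bounded_def by blast
  \<comment> \<open>Squaring the norm bound gives \<open>C\<^sup>2\<close>. The maximum with 1 gives
    \<open>M \<ge> 1\<close> and keeps the right side infinite when \<open>carleson L\<close> is, as
    \<open>0 * \<infinity> = 0\<close> in \<open>ennreal\<close>.\<close>
  have "carleson (\<tau> ` L) \<le> ennreal (max 1 (C\<^sup>2)) * carleson L" if L: "L \<subseteq> dyadic" for L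
  proof (cases "carleson L = \<infinity>")
    case True
    moreover have "0 < max 1 (C\<^sup>2)" by (simp add: less_max_iff_disj)
    then have "ennreal (max 1 (C\<^sup>2)) \<noteq> 0" by (simp only: ennreal_eq_0_iff not_le)
    ultimately show ?thesis by (simp only: ennreal_mult_top infinity_ennreal_def) simp
  next
    case False
    have \<tau>L: "\<tau> ` L \<subseteq> dyadic" using rearrangement_mem[OF \<tau>] L by auto
    define a where "a = enn2real (carleson L)"
    define b where "b = enn2real (carleson (\<tau> ` L))"
    have ab: "0 \<le> a" "0 \<le> b" by (auto simp: a_def b_def)
    have "in_BMO (indicator L)" using False by (simp add: in_BMO_def bmo_sq_indicator[OF L] less_top)
    from C[OF this] have fin: "carleson (\<tau> ` L) < \<infinity>" and le: "sqrt b \<le> C * sqrt a"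
      by (simp_all add: in_BMO_def bmo_norm_def Top_indicator[OF \<tau> L] bmo_sq_indicator[OF L]
          bmo_sq_indicator[OF \<tau>L] a_def b_def)
    have "(sqrt b)\<^sup>2 \<le> (C * sqrt a)\<^sup>2" using le ab by (intro power_mono) auto
    then have "b \<le> C\<^sup>2 * a" using ab by (simp add: power_mult_distrib)
    also have "\<dots> \<le> max 1 (C\<^sup>2) * a" using ab by (intro mult_right_mono) auto
    finally have "ennreal b \<le> ennreal (max 1 (C\<^sup>2)) * ennreal a"
      using ab by (subst ennreal_mult[symmetric]) (auto intro: ennreal_leI)
    then show ?thesis using False fin by (simp add: a_def b_def less_top)
  qed
  then show ?thesis by (intro exI[of _ "max 1 (C\<^sup>2)"]) auto
qed

lemma carleson_le_imp_packing:
  assumes M: "0 \<le> M" "\<And>L. L \<subseteq> dyadic \<Longrightarrow> carleson (\<tau> ` L) \<le> ennreal M * carleson L"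
    and L: "L \<subseteq> dyadic" "packing L (\<lambda>_. 1) c" and c: "0 \<le> c"
  shows "packing (\<tau> ` L) (\<lambda>_. 1) (M * c)"
proof -
  have "carleson (\<tau> ` L) \<le> ennreal M * carleson L" by (rule M(2)[OF L(1)])
  also have "\<dots> \<le> ennreal M * ennreal c"
    using L(2) c by (intro mult_left_mono) (auto simp: carleson_le_iff)
  also have "\<dots> = ennreal (M * c)" using M c by (simp add: ennreal_mult)
  finally show ?thesis using M(1) c by (simp add: carleson_le_iff)
qed

text \<open>Stated in \<open>ennreal\<close> so that it also covers an infinite Carleson constant;
  applied to the preimage collections in (c).\<close>

lemma sum_dlen_le_carleson:
  assumes J: "J \<in> dyadic" and G: "finite G" "G \<subseteq> dsub L J"
  shows "(\<Sum>I\<in>G. ennreal (dlen I)) \<le> ennreal (dlen J) * carleson L"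
proof (cases "carleson L = \<infinity>")
  case True
  moreover have "ennreal (dlen J) \<noteq> 0" using dlen_pos[of J] by simp
  ultimately show ?thesis by (simp only: ennreal_mult_top infinity_ennreal_def) simp
next
  case False
  define a where "a = enn2real (carleson L)"
  have a: "0 \<le> a" "carleson L = ennreal a" using False by (auto simp: a_def less_top)
  then have "packing L (\<lambda>_. 1) a" using carleson_le_iff[of a L] by simp
  from packingD[OF this J G] have "(\<Sum>I\<in>G. dlen I) \<le> dlen J * a" by (simp add: mult.commute)
  then show ?thesis using a by (simp add: sum_ennreal ennreal_mult[symmetric])
qed

subsection \<open>Construction of the decomposition\<close>

lemma sum_dlen_image_le:
  assumes \<tau>: "rearrangement \<tau>" and C: "0 \<le> C"
    and H: "\<And>L. L \<subseteq> dyadic \<Longrightarrow> packing L (\<lambda>_. 1) 4 \<Longrightarrow> packing (\<tau> ` L) (\<lambda>_. 1) C"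
    and F: "finite F" "F \<subseteq> dyadic" and J: "J \<in> dyadic" and FJ: "\<tau> ` F \<subseteq> dsub dyadic J"
    and doubling: "\<And>I K. I \<in> F \<Longrightarrow> K \<in> F \<Longrightarrow> dint K \<subset> dint I \<Longrightarrow>
      2 * (dlen (\<tau> I) / dlen I) \<le> dlen (\<tau> K) / dlen K"
  shows "(\<Sum>I\<in>F. dlen (\<tau> I)) \<le> 3 * C * dlen J"
proof -
  \<comment> \<open>A light \<open>I\<close> keeps a quarter of its length outside its descendants. For a heavy one the doubling
    makes the images of its children outweigh \<open>\<tau> I\<close> by the factor 3/2, so that the heavy intervals
    are absorbed into the full sum.\<close>
  define D where "D I = {K \<in> F. dint K \<subset> dint I}" for I
  define light where "light = {I \<in> F. measure lborel (dstar (D I)) \<le> 3 / 4 * dlen I}"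
  define heavy where "heavy = F - light"
  have finD: "finite (D I)" for I using F by (simp add: D_def)
  have "packing light (\<lambda>_. 1) 4"
  proof (rule packing_if_small_descendants)
    fix G I assume G: "finite G" "G \<subseteq> light" and I: "I \<in> G"
    have "dstar {K \<in> G. dint K \<subset> dint I} \<subseteq> dstar (D I)"
      using G(2) by (intro dstar_mono) (auto simp: light_def D_def)
    then have "measure lborel (dstar {K \<in> G. dint K \<subset> dint I}) \<le> measure lborel (dstar (D I))"
      by (rule measure_mono_fmeasurable) (use F in \<open>auto intro!: dstar_dyadic_fmeasurable simp: D_def\<close>)
    also have "\<dots> \<le> 3 / 4 * dlen I" using G I by (auto simp: light_def)
    finally show "dlen I \<le> 4 * (dlen I - measure lborel (dstar {K \<in> G. dint K \<subset> dint I}))" by simp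
  qed simp
  then have pl: "packing (\<tau> ` light) (\<lambda>_. 1) C"
    using F by (intro H) (auto simp: light_def)
  have inj: "inj_on \<tau> light" by (rule rearrangement_inj[OF \<tau>]) (use F in \<open>auto simp: light_def\<close>)
  have "(\<Sum>I\<in>light. dlen (\<tau> I)) = (\<Sum>K\<in>\<tau> ` light. 1 * dlen K)" by (simp add: sum.reindex[OF inj])
  also have "\<dots> \<le> C * dlen J"
    by (rule packingD[OF pl J]) (use F(1) FJ in \<open>auto simp: light_def dsub_def\<close>)
  finally have L: "(\<Sum>I\<in>light. dlen (\<tau> I)) \<le> C * dlen J" .
  have child: "3 / 2 * dlen (\<tau> I) \<le> (\<Sum>K\<in>dmax (D I). dlen (\<tau> K))" if I: "I \<in> heavy" for I
  proof -
    define r where "r = dlen (\<tau> I) / dlen I"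
    have r: "0 \<le> r" by (simp add: r_def)
    have IF: "I \<in> F" using I by (simp add: heavy_def)
    have "3 / 4 * dlen I \<le> measure lborel (dstar (D I))" using I by (auto simp: heavy_def light_def)
    also have "\<dots> = (\<Sum>K\<in>dmax (D I). dlen K)" by (rule measure_dstar_finite[OF finD])
    finally have "2 * r * (3 / 4 * dlen I) \<le> 2 * r * (\<Sum>K\<in>dmax (D I). dlen K)"
      using r by (intro mult_left_mono) auto
    also have "\<dots> = (\<Sum>K\<in>dmax (D I). 2 * r * dlen K)" by (simp add: sum_distrib_left)
    also have "\<dots> \<le> (\<Sum>K\<in>dmax (D I). dlen (\<tau> K))"
    proof (rule sum_mono)
      fix K assume "K \<in> dmax (D I)"
      then have K: "K \<in> F" "dint K \<subset> dint I" using dmax_subset[of "D I"] by (auto simp: D_def)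
      have "2 * r \<le> dlen (\<tau> K) / dlen K" unfolding r_def by (rule doubling[OF IF K])
      then show "2 * r * dlen K \<le> dlen (\<tau> K)" by (subst (asm) pos_le_divide_eq) auto
    qed
    also have "2 * r * (3 / 4 * dlen I) = 3 / 2 * dlen (\<tau> I)" by (simp add: r_def)
    finally show ?thesis .
  qed
  \<comment> \<open>No child is counted twice: if \<open>I\<close> lies strictly inside
    \<open>I'\<close>, then \<open>I\<close> is in \<open>D I'\<close>, so nothing strictly below
    \<open>I\<close> is maximal there.\<close>
  have disj: "dmax (D I) \<inter> dmax (D I') = {}" if II: "I \<in> F" "I' \<in> F" "I \<noteq> I'" for I I'
  proof -
    have no: "K \<notin> dmax (D B)" if "K \<in> D A" "A \<in> F" "dint A \<subset> dint B" for A B K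
    proof -
      have "A \<in> D B" "dint K \<subset> dint A" using that by (simp_all add: D_def)
      then show ?thesis unfolding dmax_def by blast
    qed
    show ?thesis
    proof (rule ccontr)
      assume "dmax (D I) \<inter> dmax (D I') \<noteq> {}"
      then obtain K where K: "K \<in> dmax (D I)" "K \<in> dmax (D I')" by blast
      then have KD: "K \<in> D I" "K \<in> D I'" using dmax_subset by blast+
      have "dint I \<noteq> dint I'" using II dint_inj by blast
      moreover have "dint I \<inter> dint I' \<noteq> {}" using KD dint_nonempty[of K] by (auto simp: D_def)
      ultimately have "dint I \<subset> dint I' \<or> dint I' \<subset> dint I" by (cases I I' rule: dint_cases) auto
      then show False using no K KD II by blast
    qed
  qed
  have hF: "heavy \<subseteq> F" "finite heavy" using F by (auto simp: heavy_def)
  have "3 / 2 * (\<Sum>I\<in>heavy. dlen (\<tau> I)) = (\<Sum>I\<in>heavy. 3 / 2 * dlen (\<tau> I))" by (rule sum_distrib_left)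
  also have "\<dots> \<le> (\<Sum>I\<in>heavy. \<Sum>K\<in>dmax (D I). dlen (\<tau> K))" by (intro sum_mono child)
  also have "\<dots> = (\<Sum>K\<in>(\<Union>I\<in>heavy. dmax (D I)). dlen (\<tau> K))"
  proof (rule sum.UNION_disjoint[symmetric, OF hF(2)])
    show "\<forall>I\<in>heavy. finite (dmax (D I))" using finite_dmax[OF finD] by blast
    show "\<forall>I\<in>heavy. \<forall>I'\<in>heavy. I \<noteq> I' \<longrightarrow> dmax (D I) \<inter> dmax (D I') = {}"
      using disj hF(1) by (meson subsetD)
  qed
  also have "\<dots> \<le> (\<Sum>K\<in>F. dlen (\<tau> K))"
  proof (rule sum_mono2[OF F(1)])
    show "(\<Union>I\<in>heavy. dmax (D I)) \<subseteq> F" using dmax_subset by (fastforce simp: D_def)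
  qed simp
  finally have Hv: "3 / 2 * (\<Sum>I\<in>heavy. dlen (\<tau> I)) \<le> (\<Sum>K\<in>F. dlen (\<tau> K))" .
  \<comment> \<open>The heavy sum is at most two thirds of the full sum, so the light sum is at
    least one third of it: hence the factor 3.\<close>
  have "(\<Sum>I\<in>F. dlen (\<tau> I)) = (\<Sum>I\<in>heavy. dlen (\<tau> I)) + (\<Sum>I\<in>light. dlen (\<tau> I))"
    unfolding heavy_def by (rule sum.subset_diff) (use F in \<open>auto simp: light_def\<close>)
  then show ?thesis using L Hv by linarith
qed

section \<open>Records of the length ratio and their groups\<close>

lemma dlen_ratio_less_imp_double:
  assumes "dlen A / dlen B < dlen C / dlen D"
  shows "2 * (dlen A / dlen B) \<le> dlen C / dlen D"
proof -
  \<comment> \<open>Cross-multiplied, both sides are powers of two, so a strict inequality gains a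
    full factor 2.\<close>
  have "(2::real) ^ (fst B + fst C) < 2 ^ (fst A + fst D)"
    using assms by (simp add: dlen_eq power_add field_simps)
  then have "fst B + fst C + 1 \<le> fst A + fst D" by simp
  then have "(2::real) ^ (fst B + fst C + 1) \<le> 2 ^ (fst A + fst D)" by (intro power_increasing) auto
  then show ?thesis by (simp add: dlen_eq power_add field_simps)
qed

text \<open>The tops: strict running maxima of the ratio when descending along chains.\<close>

definition records :: "(nat \<times> nat \<Rightarrow> nat \<times> nat) \<Rightarrow> (nat \<times> nat) set \<Rightarrow> (nat \<times> nat) set" where
  "records \<tau> L = {I \<in> L. \<forall>K\<in>L. dint I \<subset> dint K \<longrightarrow> dlen (\<tau> K) / dlen K < dlen (\<tau> I) / dlen I}"

text \<open>A non-record has a strictly larger interval of at least the same ratio; the climb ends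
  because levels drop.\<close>

lemma ex_record_above:
  assumes "I \<in> L"
  shows "\<exists>T\<in>records \<tau> L. dint I \<subseteq> dint T \<and> dlen (\<tau> I) / dlen I \<le> dlen (\<tau> T) / dlen T"
  using assms
proof (induction "fst I" arbitrary: I rule: less_induct)
  case less
  show ?case
  proof (cases "I \<in> records \<tau> L")
    case False
    then obtain K where K: "K \<in> L" "dint I \<subset> dint K" "dlen (\<tau> I) / dlen I \<le> dlen (\<tau> K) / dlen K"
      using less.prems by (auto simp: records_def not_less)
    from less.hyps[OF dint_strict_level[OF K(2)] K(1)] obtain T where
      "T \<in> records \<tau> L" "dint K \<subseteq> dint T" "dlen (\<tau> K) / dlen K \<le> dlen (\<tau> T) / dlen T" by blast
    then show ?thesis using K by (intro bexI[of _ T]) auto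
  qed auto
qed

text \<open>The maximal images cover the set. Each is at most the ratio of \<open>T\<close> times
  its preimage, and the preimages lie below \<open>T\<close>, so \<open>dlen T\<close> times their
  Carleson constant bounds their total length.\<close>

lemma emeasure_dstar_image_le:
  assumes \<tau>: "rearrangement \<tau>" and T: "T \<in> dyadic" and A: "A \<subseteq> dsub dyadic T"
    and ratio: "\<And>I. I \<in> A \<Longrightarrow> dlen (\<tau> I) / dlen I \<le> dlen (\<tau> T) / dlen T"
  shows "emeasure lborel (dstar (\<tau> ` A)) \<le> ennreal (dlen (\<tau> T)) * carleson (rinv \<tau> ` dmax (\<tau> ` A))"
proof -
  have Ad: "A \<subseteq> dyadic" using A by (auto simp: dsub_def)
  define r where "r = dlen (\<tau> T) / dlen T"
  have r: "0 \<le> r" by (simp add: r_def)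
  have "emeasure lborel (dstar (dmax (\<tau> ` A))) \<le> ennreal (dlen (\<tau> T)) * carleson (rinv \<tau> ` dmax (\<tau> ` A))"
  proof (rule emeasure_dstar_le)
    show "dmax (\<tau> ` A) \<subseteq> dyadic"
      using dmax_subset[of "\<tau> ` A"] Ad rearrangement_mem[OF \<tau>] by blast
    fix F assume F: "finite F" "F \<subseteq> dmax (\<tau> ` A)"
    define G where "G = rinv \<tau> ` F"
    have FA: "F \<subseteq> \<tau> ` A" using F(2) dmax_subset by (rule order_trans)
    have tau_rinv: "\<tau> (rinv \<tau> K) = K" "rinv \<tau> K \<in> A" if "K \<in> F" for K
    proof -
      obtain I where I: "I \<in> A" "K = \<tau> I" using \<open>K \<in> F\<close> FA by blast
      then have "I \<in> dyadic" using Ad by blast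
      then show "\<tau> (rinv \<tau> K) = K" "rinv \<tau> K \<in> A" using I \<tau> by simp_all
    qed
    have inj: "inj_on (rinv \<tau>) F" by (rule inj_on_inverseI) (rule tau_rinv)
    have GA: "G \<subseteq> A" using tau_rinv by (auto simp: G_def)
    have "(\<Sum>K\<in>F. ennreal (dlen K)) = (\<Sum>I\<in>G. ennreal (dlen (\<tau> I)))"
      unfolding G_def by (simp add: sum.reindex[OF inj] tau_rinv)
    also have "\<dots> \<le> (\<Sum>I\<in>G. ennreal r * ennreal (dlen I))"
    proof (rule sum_mono)
      fix I assume "I \<in> G"
      then have "dlen (\<tau> I) / dlen I \<le> r" using ratio GA unfolding r_def by blast
      then have "dlen (\<tau> I) \<le> r * dlen I" by (subst (asm) pos_divide_le_eq) auto
      then show "ennreal (dlen (\<tau> I)) \<le> ennreal r * ennreal (dlen I)"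
        using r by (simp add: ennreal_mult[symmetric])
    qed
    also have "\<dots> = ennreal r * (\<Sum>I\<in>G. ennreal (dlen I))" by (rule sum_distrib_left[symmetric])
    also have "\<dots> \<le> ennreal r * (ennreal (dlen T) * carleson (rinv \<tau> ` dmax (\<tau> ` A)))"
    proof (intro mult_left_mono sum_dlen_le_carleson[OF T])
      show "finite G" using F by (simp add: G_def)
      show "G \<subseteq> dsub (rinv \<tau> ` dmax (\<tau> ` A)) T"
        using F(2) GA A by (auto simp: dsub_def G_def)
    qed simp
    also have "\<dots> = ennreal (dlen (\<tau> T)) * carleson (rinv \<tau> ` dmax (\<tau> ` A))"
      using r by (simp add: mult.assoc[symmetric] ennreal_mult[symmetric] r_def)
    finally show "(\<Sum>K\<in>F. ennreal (dlen K)) \<le> ennreal (dlen (\<tau> T)) * carleson (rinv \<tau> ` dmax (\<tau> ` A))" .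
  qed
  then show ?thesis by (simp add: dstar_dmax)
qed

lemma carleson_le_imp_weak_property_P:
  assumes \<tau>: "rearrangement \<tau>" and M: "1 \<le> M"
    and H: "\<And>L. L \<subseteq> dyadic \<Longrightarrow> carleson (\<tau> ` L) \<le> ennreal M * carleson L"
  shows "weak_property_P \<tau>"
  unfolding weak_property_P_iff
\<comment> \<open>The 12 is the 3 of \<open>sum_dlen_image_le\<close> times the Carleson constant 4
  used there.\<close>
proof (intro exI[of _ "12 * M"] conjI allI ballI impI)
  show "0 < 12 * M" using M by simp
  fix B J assume B: "B \<subseteq> dyadic" and J: "J \<in> dyadic"
  define L where "L = {I \<in> B. \<tau> I \<in> dsub dyadic J}"
  define S where "S = records \<tau> L"
  have Ld: "L \<subseteq> dyadic" and SL: "S \<subseteq> L" using B by (auto simp: L_def S_def records_def)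
  \<comment> \<open>Tops are assigned to themselves, so each nonempty group contains its
    top.\<close>
  have "\<exists>T\<in>S. dint I \<subseteq> dint T \<and> dlen (\<tau> I) / dlen I \<le> dlen (\<tau> T) / dlen T \<and> (I \<in> S \<longrightarrow> T = I)"
    if "I \<in> L" for I
    using ex_record_above[OF that, of \<tau>] by (cases "I \<in> S") (auto simp: S_def)
  then obtain f where f: "\<And>I. I \<in> L \<Longrightarrow> f I \<in> S" "\<And>I. I \<in> L \<Longrightarrow> dint I \<subseteq> dint (f I)"
      "\<And>I. I \<in> L \<Longrightarrow> dlen (\<tau> I) / dlen I \<le> dlen (\<tau> (f I)) / dlen (f I)"
      "\<And>I. I \<in> S \<Longrightarrow> f I = I"
    using SL by (metis subsetD)
  \<comment> \<open>An enumeration of all pairs indexes the groups by \<open>nat\<close>; an index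
    whose pair is not a top has an empty group.\<close>
  define T :: "nat \<Rightarrow> nat \<times> nat" where "T = prod_decode"
  define A where "A i = {I \<in> L. f I = T i}" for i
  have T_inj: "inj T" and T_surj: "surj T"
    using bij_prod_decode by (auto simp: T_def bij_def)
  have AL: "A i \<subseteq> L" for i by (auto simp: A_def)
  have Ad: "A i \<subseteq> dyadic" for i using AL Ld by blast
  have top: "T i \<in> S" "T i \<in> A i" "A i \<subseteq> dsub dyadic (T i)"
    and ratio: "\<And>I. I \<in> A i \<Longrightarrow> dlen (\<tau> I) / dlen I \<le> dlen (\<tau> (T i)) / dlen (T i)"
    if "A i \<noteq> {}" for i
  proof -
    obtain I where "I \<in> A i" using \<open>A i \<noteq> {}\<close> by blast
    then have "I \<in> L" "f I = T i" by (simp_all add: A_def)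
    then show TS: "T i \<in> S" using f(1) by metis
    then show "T i \<in> A i" using SL f(4) by (auto simp: A_def)
    show "A i \<subseteq> dsub dyadic (T i)"
    proof
      fix I assume "I \<in> A i"
      then have "I \<in> L" "f I = T i" by (auto simp: A_def)
      then show "I \<in> dsub dyadic (T i)" using Ld f(2)[of I] by (auto simp: dsub_def)
    qed
    fix I assume "I \<in> A i"
    then have "I \<in> L" "f I = T i" by (auto simp: A_def)
    then show "dlen (\<tau> I) / dlen I \<le> dlen (\<tau> (T i)) / dlen (T i)" using f(3)[of I] by simp
  qed
  have fm: "dstar (\<tau> ` A i) \<in> fmeasurable lborel" for i
    using Ad[of i] rearrangement_mem[OF \<tau>] by (intro dstar_dyadic_fmeasurable) blast
  \<comment> \<open>Empty groups count 0, so only images of tops are summed.\<close>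
  define s where "s i = (if A i = {} then 0 else dlen (\<tau> (T i)))" for i
  have H4: "packing (\<tau> ` L) (\<lambda>_. 1) (M * 4)" if "L \<subseteq> dyadic" "packing L (\<lambda>_. 1) 4" for L
    by (rule carleson_le_imp_packing[OF _ H that]) (use M in auto)
  have "(\<Sum>i. ennreal (s i)) \<le> ennreal (12 * M * dlen J)"
    unfolding suminf_eq_SUP
  proof (rule SUP_least)
    fix n
    define N where "N = {i. i < n \<and> A i \<noteq> {}}"
    have inj: "inj_on T N" using T_inj by (rule inj_on_subset) simp
    have "T i \<in> S" if "i \<in> N" for i using top(1)[of i] that by (simp add: N_def)
    then have TS: "T ` N \<subseteq> S" by blast
    have "(\<Sum>i<n. s i) = (\<Sum>i\<in>N. dlen (\<tau> (T i)))"
      by (intro sum.mono_neutral_cong_right) (auto simp: N_def s_def)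
    also have "\<dots> = (\<Sum>I\<in>T ` N. dlen (\<tau> I))" by (simp add: sum.reindex[OF inj])
    also have "\<dots> \<le> 3 * (M * 4) * dlen J"
    proof (rule sum_dlen_image_le[OF \<tau> _ H4 _ _ J])
      show "0 \<le> M * 4" using M by simp
      show "finite (T ` N)" by (simp add: N_def)
      show "T ` N \<subseteq> dyadic" using TS SL Ld by blast
      have "\<tau> I \<in> dsub dyadic J" if "I \<in> L" for I using that by (simp add: L_def)
      then show "\<tau> ` (T ` N) \<subseteq> dsub dyadic J" using TS SL by blast
      fix I K assume "I \<in> T ` N" "K \<in> T ` N" and IK: "dint K \<subset> dint I"
      then have "I \<in> S" "K \<in> S" using TS by blast+
      then show "2 * (dlen (\<tau> I) / dlen I) \<le> dlen (\<tau> K) / dlen K"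
        using IK SL by (intro dlen_ratio_less_imp_double) (auto simp: S_def records_def)
    qed
    finally show "(\<Sum>i<n. ennreal (s i)) \<le> ennreal (12 * M * dlen J)"
      using M by (simp add: sum_ennreal s_def)
  qed
  note s_sum = this
  have "P_decomposition \<tau> (12 * M) B J A (\<lambda>_. {})"
    unfolding P_decomposition_def
  proof (intro conjI allI impI ballI)
    show "A i \<subseteq> dyadic" for i by (rule Ad)
    have "\<tau> I \<in> (\<Union>i. \<tau> ` A i)" if "I \<in> L" for I
    proof -
      obtain i where "f I = T i" using T_surj by (metis surjD)
      then show ?thesis using that by (auto simp: A_def)
    qed
    then have "\<tau> ` L \<subseteq> (\<Union>i. \<tau> ` A i)" by (rule image_subsetI)
    moreover have "(\<Union>i. \<tau> ` A i) \<subseteq> \<tau> ` L" by (intro UN_least image_mono AL)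
    moreover have "dsub (\<tau> ` B) J = \<tau> ` L" using B rearrangement_mem[OF \<tau>] by (auto simp: dsub_def L_def)
    ultimately show "dsub (\<tau> ` B) J = (\<Union>i. \<tau> ` A i) \<union> (\<Union>i::nat. {})"
      by (simp add: subset_antisym)
    show "\<tau> ` A i \<inter> \<tau> ` A j = {}" if "i \<noteq> j" for i j
    proof -
      have "T i \<noteq> T j" using that T_inj by (simp add: inj_eq)
      then have "A i \<inter> A j = {}" by (auto simp: A_def)
      then show ?thesis
        using inj_on_image_Int[OF rearrangement_inj[OF \<tau> subset_refl] Ad Ad, of i j] by simp
    qed
    show "carleson (\<Union>i::nat. {}) \<le> ennreal (12 * M)"
      using M by (subst carleson_le_iff) (auto simp: packing_def dsub_def)
    show "dlen (\<tau> I) / dlen I \<le> 12 * M * (measure lborel (dstar (\<tau> ` A i)) + measure lborel (dstar {}))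
        / measure lborel (dstar (A i))" if I: "I \<in> A i" for i I
    proof -
      have ne: "A i \<noteq> {}" using I by blast
      \<comment> \<open>The top contains its group and belongs to it, so the denominator in (b) is
        \<open>dlen (T i)\<close>.\<close>
      have "dstar (A i) = dint (T i)" using top[OF ne] by (auto simp: dstar_def dsub_def)
      then have m: "measure lborel (dstar (A i)) = dlen (T i)" by simp
      have "measure lborel (dint (\<tau> (T i))) \<le> measure lborel (dstar (\<tau> ` A i))"
        using top(2)[OF ne] fm by (intro measure_mono_fmeasurable) (auto simp: dstar_def)
      then have "dlen (\<tau> (T i)) \<le> measure lborel (dstar (\<tau> ` A i))" by simp
      also have "\<dots> \<le> 12 * M * (measure lborel (dstar (\<tau> ` A i)) + measure lborel (dstar {}))"
        using M mult_right_mono[of 1 "12 * M" "measure lborel (dstar (\<tau> ` A i))"] by (simp add: dstar_def)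
      finally show ?thesis
        unfolding m using ratio[OF ne I] divide_right_mono[OF _ dlen_nonneg[of "T i"]] by (meson order_trans)
    qed
    let ?Z = "SUP i. carleson (rinv \<tau> ` dmax (\<tau> ` A i))"
    \<comment> \<open>Bounding each group's Carleson constant by the supremum gives a common factor
      that leaves the sum.\<close>
    have "ennreal (measure lborel (dstar (\<tau> ` A i))) \<le> ennreal (s i) * ?Z" for i
    proof (cases "A i = {}")
      case False
      have "emeasure lborel (dstar (\<tau> ` A i)) \<le> ennreal (dlen (\<tau> (T i))) * carleson (rinv \<tau> ` dmax (\<tau> ` A i))"
        using top[OF False] SL Ld ratio[OF False] by (intro emeasure_dstar_image_le[OF \<tau>]) auto
      also have "\<dots> \<le> ennreal (s i) * ?Z"
        using False by (auto simp: s_def intro!: mult_left_mono SUP_upper)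
      finally show ?thesis using fm by (simp add: emeasure_eq_measure2)
    qed (simp add: dstar_def)
    then have "(\<Sum>i. ennreal (measure lborel (dstar (\<tau> ` A i)))) \<le> (\<Sum>i. ennreal (s i) * ?Z)"
      by (intro suminf_le) auto
    also have "\<dots> = (\<Sum>i. ennreal (s i)) * ?Z" by (rule ennreal_suminf_multc)
    also have "\<dots> \<le> ennreal (12 * M * dlen J) * ?Z" using s_sum by (rule mult_right_mono) simp
    finally show "(\<Sum>i. ennreal (measure lborel (dstar (\<tau> ` A i)))) \<le> ennreal (12 * M * dlen J) * ?Z" .
  qed auto
  then show "\<exists>L E. P_decomposition \<tau> (12 * M) B J L E" by blast
qed

theorem theorem2:
  fixes \<tau> :: "nat \<times> nat \<Rightarrow> nat \<times> nat"
  assumes "rearrangement \<tau>"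
  shows "(BMO_bounded \<tau> \<longleftrightarrow>
            (\<exists>M::real\<ge>1. \<forall>L\<subseteq>dyadic. carleson (\<tau> ` L) \<le> ennreal M * carleson L))
       \<and> ((\<exists>M::real\<ge>1. \<forall>L\<subseteq>dyadic. carleson (\<tau> ` L) \<le> ennreal M * carleson L)
            \<longleftrightarrow> weak_property_P \<tau>)"
proof -
  let ?ii = "\<exists>M::real\<ge>1. \<forall>L\<subseteq>dyadic. carleson (\<tau> ` L) \<le> ennreal M * carleson L"
  have "?ii" if "BMO_bounded \<tau>"
    using BMO_bounded_imp_carleson_le[OF assms that] .
  moreover have "weak_property_P \<tau>" if ii: "?ii"
  proof -
    from ii obtain M where M: "1 \<le> M" "\<And>L. L \<subseteq> dyadic \<Longrightarrow> carleson (\<tau> ` L) \<le> ennreal M * carleson L"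
      by blast
    show ?thesis by (rule carleson_le_imp_weak_property_P[OF assms M])
  qed
  moreover have "BMO_bounded \<tau>" if wp: "weak_property_P \<tau>"
  proof -
    from weak_property_P_imp_packing[OF assms wp] obtain C where C: "0 \<le> C"
      "\<And>L. L \<subseteq> dyadic \<Longrightarrow> packing L (\<lambda>_. 1) 2 \<Longrightarrow> packing (\<tau> ` L) (\<lambda>_. 1) C"
      by blast
    show ?thesis by (rule packing_imp_BMO_bounded[OF assms C])
  qed
  ultimately show ?thesis by argo
qed

end
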